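(* Let $\psi:[0,\infty)\to[0,\infty)$ be non-decreasing and left-continuous, $n\ge1$, $\alpha\in(0,n)$, and let $\Omega\subseteq\mathbb{R}^n$ be a measurable set. Let $X(\Omega)$ and $Y(\Omega)$ be quasi-normed Banach rearrangement invariant function spaces, with representation spaces $\overline X(0,|\Omega|)$ and $\overline Y(0,|\Omega|)$. Consider the assertions: (i) there exists a constant $c>0$ such that for every nonnegative $\phi\in\overline X(0,|\Omega|)$ $$\left\|\int_t^\infty s^{\frac{\alpha}{n}-1}\psi\!\left(s^{\frac{\alpha}{n}-1}\int_0^s\phi(y)\,dy\right)ds\right\|_{\overline Y(0,|\Omega|)}\le c\,\|\phi\|_{\overline X(0,|\Omega|)}$$ (the function inside the norm on the left being a function of $t\in(0,|\Omega|)$); (ii) there exists a constant $c>0$ such that for every $f\in X(\Omega)$ $$\|\mathbf{W}_{\alpha,\psi}f\|_{Y(\Omega)}\le c\,\|f\|_{X(\Omega)}.$$ Then (i) implies (ii). Moreover, if $\Omega=\mathbb{R}^n$, then also (ii) implies (i).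
   Context: $\mathbf{W}_{\alpha,\psi}f(x):=\int_0^\infty r^{\alpha-1}\psi\big(r^{\alpha-n}\int_{B(x,r)}|f(y)|\,dy\big)dr$. Functions on $\Omega$ (resp. on $(0,|\Omega|)$) are extended by $0$ outside. Throughout, the potential is only applied to measurable $f$ with $|\{x:|f(x)|>\tau\}|<\infty$ for all $\tau>0$. The norm of a function not in the space is $+\infty$; $\psi(\infty):=\lim_{s\to\infty}\psi(s)$. A quasi-normed (Banach) function space $X(\Omega)$ is a linear space of measurable functions on $\Omega$ with a functional $\|\cdot\|_{X(\Omega)}$ such that: (1) $\|f\|>0$ if $f\ne0$, $\|\lambda f\|=|\lambda|\|f\|$ for $\lambda \in\mathbb{R}$, and $\|f+g\|\le c(\|f\|+\|g\|)$ for some constant $c\ge1$; (2) $0\le|g|\le|f|$ a.e. implies $\|g\|\le\|f\|$; (3) $0\le f_k\nearrow f$ a.e. implies $\|f_k\|\nearrow\|f\|$; (4) $\|\mathbf 1_E\|<\infty$ for measurable $E\subset\Omega$ with $|E|<\infty$; (5) for every measurable $E\subset\Omega$ with $|E|<\infty$ there is a constant $C$ with $\int_E|f|\,dx\le C\|f\|$ for all $f\in X(\Omega)$. It is rearrangement invariant if $\|f\|=\|g\|$ whenever $f,g$ are finite a.e. and equimeasurable, i.e. $|\{|f|>t\}|=|\{|g|>t\}|$ for all $t>0$. Its representation space $\overline X(0,|\Omega|)$ is the rearrangement invariant space on $(0,|\Omega|)$ such that $\|f\|_{X(\Omega)}=\|f^*\|_{\overline X(0,|\Omega|)}$ for every $f\in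 X(\Omega)$, where $f^*(t):=\sup\{s\ge0:|\{|f|>s\}|>t\}$ is the decreasing rearrangement. *)

theory Defs
  imports "HOL-Analysis.Analysis"
begin

text \<open>
  A function on \<open>\<Omega>\<close> is a total function on the ambient type whose values outside \<open>\<Omega>\<close> are
  irrelevant. Functions are extended real valued because the potentials may be infinite.

  A function space is given by its functional \<open>N\<close> alone, defined on all functions with the
  convention that \<open>N f = \<infinity>\<close> when \<open>f\<close> is not in the space; thus \<open>f\<close> belongs to the space
  iff \<open>N f < \<infinity>\<close>. The value of \<open>\<infinity> + (- \<infinity>)\<close> plays no role in the quasi-triangle inequality:
  by the last axiom the members of the space are finite almost everywhere.
\<close>

definition quasi_normed_function_space ::
  "'a::euclidean_space set \<Rightarrow> (('a \<Rightarrow> ereal) \<Rightarrow> ennreal) \<Rightarrow> bool" where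
  "quasi_normed_function_space \<Omega> N \<longleftrightarrow>
     (\<forall>f. N f < \<infinity> \<longrightarrow> f \<in> borel_measurable (lebesgue_on \<Omega>)) \<and>
     (\<forall>f\<in>borel_measurable (lebesgue_on \<Omega>).
        \<not> (AE x in lebesgue_on \<Omega>. f x = 0) \<longrightarrow> 0 < N f) \<and>
     (\<forall>f (a::real). N f < \<infinity> \<longrightarrow> N (\<lambda>x. ereal a * f x) = ennreal \<bar>a\<bar> * N f) \<and>
     (\<exists>c::real. 1 \<le> c \<and>
        (\<forall>f g. N f < \<infinity> \<and> N g < \<infinity> \<longrightarrow> N (\<lambda>x. f x + g x) \<le> ennreal c * (N f + N g))) \<and>
     (\<forall>f\<in>borel_measurable (lebesgue_on \<Omega>). \<forall>g\<in>borel_measurable (lebesgue_on \<Omega>).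
        (AE x in lebesgue_on \<Omega>. \<bar>g x\<bar> \<le> \<bar>f x\<bar>) \<longrightarrow> N g \<le> N f) \<and>
     (\<forall>(F :: nat \<Rightarrow> 'a \<Rightarrow> ereal) f.
        (\<forall>k. F k \<in> borel_measurable (lebesgue_on \<Omega>)) \<and> f \<in> borel_measurable (lebesgue_on \<Omega>) \<and>
        (AE x in lebesgue_on \<Omega>.
           (\<forall>k. 0 \<le> F k x) \<and> incseq (\<lambda>k. F k x) \<and> (\<lambda>k. F k x) \<longlonglongrightarrow> f x) \<longrightarrow>
        incseq (\<lambda>k. N (F k)) \<and> (\<lambda>k. N (F k)) \<longlonglongrightarrow> N f) \<and>
     (\<forall>E. E \<in> sets lebesgue \<and> E \<subseteq> \<Omega> \<and> emeasure lebesgue E < \<infinity> \<longrightarrow> N (indicator E) < \<infinity>) \<and>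
     (\<forall>E. E \<in> sets lebesgue \<and> E \<subseteq> \<Omega> \<and> emeasure lebesgue E < \<infinity> \<longrightarrow>
        (\<exists>C::real. \<forall>f. N f < \<infinity> \<longrightarrow>
           (\<integral>\<^sup>+x\<in>E. e2ennreal \<bar>f x\<bar> \<partial>lebesgue_on \<Omega>) \<le> ennreal C * N f))"

definition distribution_on :: "'a::euclidean_space set \<Rightarrow> ('a \<Rightarrow> ereal) \<Rightarrow> real \<Rightarrow> ennreal" where
  "distribution_on \<Omega> f s = emeasure lebesgue {x\<in>\<Omega>. ereal s < \<bar>f x\<bar>}"

definition rearrangement_invariant_space ::
  "'a::euclidean_space set \<Rightarrow> (('a \<Rightarrow> ereal) \<Rightarrow> ennreal) \<Rightarrow> bool" where
  "rearrangement_invariant_space \<Omega> N \<longleftrightarrow>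
     quasi_normed_function_space \<Omega> N \<and>
     (\<forall>f\<in>borel_measurable (lebesgue_on \<Omega>). \<forall>g\<in>borel_measurable (lebesgue_on \<Omega>).
        (AE x in lebesgue_on \<Omega>. \<bar>f x\<bar> < \<infinity>) \<and> (AE x in lebesgue_on \<Omega>. \<bar>g x\<bar> < \<infinity>) \<and>
        (\<forall>t>0. distribution_on \<Omega> f t = distribution_on \<Omega> g t) \<longrightarrow> N f = N g)"

text \<open>The supremum is taken in \<^typ>\<open>ennreal\<close>, where the supremum of the empty set is \<open>0\<close>
  (in \<^typ>\<open>ereal\<close> it would be \<open>- \<infinity>\<close>).\<close>

definition decreasing_rearrangement ::
  "'a::euclidean_space set \<Rightarrow> ('a \<Rightarrow> ereal) \<Rightarrow> real \<Rightarrow> ereal" where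
  "decreasing_rearrangement \<Omega> f t =
     enn2ereal (Sup {ennreal s |s::real. 0 \<le> s \<and> ennreal t < distribution_on \<Omega> f s})"

definition measure_interval :: "'a::euclidean_space set \<Rightarrow> real set" where
  "measure_interval \<Omega> = {t. 0 < t \<and> ennreal t < emeasure lebesgue \<Omega>}"

definition representation_space ::
  "'a::euclidean_space set \<Rightarrow> (('a \<Rightarrow> ereal) \<Rightarrow> ennreal) \<Rightarrow> ((real \<Rightarrow> ereal) \<Rightarrow> ennreal) \<Rightarrow> bool" where
  "representation_space \<Omega> N N' \<longleftrightarrow>
     rearrangement_invariant_space (measure_interval \<Omega>) N' \<and>
     (\<forall>f. N f < \<infinity> \<longrightarrow> N f = N' (decreasing_rearrangement \<Omega> f))"

definition extend_by_zero :: "'b set \<Rightarrow> ('b \<Rightarrow> ereal) \<Rightarrow> 'b \<Rightarrow> ereal" where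
  "extend_by_zero S f x = (if x \<in> S then f x else 0)"

definition extend_at_infinity :: "(real \<Rightarrow> real) \<Rightarrow> ennreal \<Rightarrow> ennreal" where
  "extend_at_infinity \<psi> u =
     (if u = \<infinity> then Lim at_top (\<lambda>s::real. ennreal (\<psi> s)) else ennreal (\<psi> (enn2real u)))"

definition wolff_potential ::
  "real \<Rightarrow> (real \<Rightarrow> real) \<Rightarrow> ('a::euclidean_space \<Rightarrow> ereal) \<Rightarrow> 'a \<Rightarrow> ennreal" where
  "wolff_potential \<alpha> \<psi> f x =
     (\<integral>\<^sup>+r\<in>{0<..}. ennreal (r powr (\<alpha> - 1)) *
        extend_at_infinity \<psi>
          (ennreal (r powr (\<alpha> - real DIM('a))) * (\<integral>\<^sup>+y\<in>ball x r. e2ennreal \<bar>f y\<bar> \<partial>lebesgue))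
        \<partial>lborel)"

text \<open>The parameter \<open>\<beta>\<close> stands for \<open>\<alpha> / n\<close>.\<close>

definition hardy_operator :: "real \<Rightarrow> (real \<Rightarrow> real) \<Rightarrow> (real \<Rightarrow> ereal) \<Rightarrow> real \<Rightarrow> ennreal" where
  "hardy_operator \<beta> \<psi> \<phi> t =
     (\<integral>\<^sup>+s\<in>{t<..}. ennreal (s powr (\<beta> - 1)) *
        extend_at_infinity \<psi>
          (ennreal (s powr (\<beta> - 1)) * (\<integral>\<^sup>+y\<in>{0<..<s}. e2ennreal (\<phi> y) \<partial>lebesgue))
        \<partial>lborel)"

definition hardy_bounded ::
  "real \<Rightarrow> (real \<Rightarrow> real) \<Rightarrow> 'a::euclidean_space set \<Rightarrow>
   ((real \<Rightarrow> ereal) \<Rightarrow> ennreal) \<Rightarrow> ((real \<Rightarrow> ereal) \<Rightarrow> ennreal) \<Rightarrow> bool" where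
  "hardy_bounded \<alpha> \<psi> \<Omega> NX' NY' \<longleftrightarrow>
     (\<exists>c::real. 0 < c \<and>
        (\<forall>\<phi>. NX' \<phi> < \<infinity> \<and> (\<forall>t\<in>measure_interval \<Omega>. 0 \<le> \<phi> t) \<longrightarrow>
           NY' (\<lambda>t. enn2ereal (hardy_operator (\<alpha> / real DIM('a)) \<psi>
                     (extend_by_zero (measure_interval \<Omega>) \<phi>) t))
             \<le> ennreal c * NX' \<phi>))"

text \<open>The potential is only applied to functions all of whose superlevel sets at positive heights
  have finite measure.\<close>

definition potential_bounded ::
  "real \<Rightarrow> (real \<Rightarrow> real) \<Rightarrow> 'a::euclidean_space set \<Rightarrow>
   (('a \<Rightarrow> ereal) \<Rightarrow> ennreal) \<Rightarrow> (('a \<Rightarrow> ereal) \<Rightarrow> ennreal) \<Rightarrow> bool" where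
  "potential_bounded \<alpha> \<psi> \<Omega> NX NY \<longleftrightarrow>
     (\<exists>c::real. 0 < c \<and>
        (\<forall>f. NX f < \<infinity> \<and> (\<forall>\<tau>>0. distribution_on \<Omega> f \<tau> < \<infinity>) \<longrightarrow>
           NY (\<lambda>x. enn2ereal (wolff_potential \<alpha> \<psi> (extend_by_zero \<Omega> f) x))
             \<le> ennreal c * NX f))"

end

theory Submission
  imports Defs
begin

text \<open>
  By Vitali covering and the Hardy-Littlewood inequality, outside a set of measure at most \<open>t\<close> every
  ball average of \<open>f\<close> is at most \<open>5\<^sup>n t\<^sup>-\<^sup>1 F(t)\<close> with \<open>F(t)\<close> the integral of \<open>f\<^sup>*\<close> over \<open>(0, t)\<close>. At such points
  the part of the potential with \<open>|B(x, r)| \<le> t\<close> is controlled by this average and the rest by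
  \<open>\<integral>\<^bsub>B(x, r)\<^esub> |f| \<le> F(|B(x, r)|)\<close>, so that \<open>(W f)\<^sup>*(t)\<close> is at most a multiple of the Hardy operator
  applied to \<open>C f\<^sup>*\<close>. Since \<open>\<psi>\<close> need not be doubling, the constant \<open>C\<close> stays inside \<open>\<psi>\<close>; it is absorbed by
  the homogeneity of the norm of \<open>X\<close>. Conversely, for the radial function \<open>g(x) = \<phi>\<^sup>*(\<omega> |x|\<^sup>n)\<close> the
  potential is bounded below by the Hardy operator of \<open>\<phi>\<^sup>*\<close> on a ball of measure greater than \<open>t\<close>.
\<close>

text \<open>A space and its representation space are linked by
  \<open>N f = N' (decreasing_rearrangement \<Omega> f)\<close> for members \<open>f\<close> only,
  and the potential of a member of X is not known beforehand to lie in Y. The rearrangement bound is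
  therefore applied to the potential cut off in height and support; such functions lie in Y because
  indicators of sets of finite measure do, and the monotone convergence axiom returns the bound for
  the potential itself. The exceptional set of small measure is allowed to depend on
  \<open>t\<close>, because a rearrangement is at most \<open>b\<close> at \<open>t\<close> as soon
  as the function is at most \<open>b\<close> off some set of measure at most \<open>t\<close>. The
  near part of the potential is compared with the piece of the Hardy integral over
  \<open>(t, 2 * t]\<close> alone. The argument of \<psi> loses a fixed power of 2 there, which
  joins the Vitali constant inside \<psi>.\<close>

section \<open>Measurability of monotone functions\<close>

lemma borel_measurable_antimono_real:
  fixes f :: "real \<Rightarrow> 'b::{second_countable_topology, linorder_topology}"
  assumes "antimono f"
  shows "f \<in> borel_measurable borel"
proof (rule borel_measurableI_greater)
  fix y
  have "is_interval {x. y < f x}"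
    unfolding is_interval_1 using antimonoD[OF assms] by (blast intro: less_le_trans)
  then show "{x \<in> space borel. y < f x} \<in> sets borel"
    by (simp add: real_interval_borel_measurable)
qed

lemma borel_measurable_mono_real:
  fixes f :: "real \<Rightarrow> 'b::{second_countable_topology, linorder_topology}"
  assumes "mono f"
  shows "f \<in> borel_measurable borel"
proof (rule borel_measurableI_greater)
  fix y
  have "is_interval {x. y < f x}"
    unfolding is_interval_1 using monoD[OF assms] by (blast intro: less_le_trans)
  then show "{x \<in> space borel. y < f x} \<in> sets borel"
    by (simp add: real_interval_borel_measurable)
qed

text \<open>A sublevel set of a monotone function is closed downwards, hence in a complete linear
  order a ray with or without its supremum. The case needed is
  \<open>extend_at_infinity \<psi>\<close>, whose argument ranges over
  \<open>ennreal\<close>.\<close>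

lemma borel_measurable_mono_complete:
  fixes f :: "'a::{complete_linorder, second_countable_topology, linorder_topology} \<Rightarrow>
    'b::{second_countable_topology, linorder_topology}"
  assumes "mono f"
  shows "f \<in> borel_measurable borel"
proof (rule borel_measurableI_le)
  fix y
  let ?D = "{x. f x \<le> y}"
  have "?D = {..Sup ?D} \<or> ?D = {..<Sup ?D}"
  proof (cases "Sup ?D \<in> ?D")
    case True
    then show ?thesis
      using monoD[OF assms] by (auto intro: Sup_upper order_trans)
  next
    case False
    have "x \<in> ?D" if "x < Sup ?D" for x
      using that monoD[OF assms] unfolding less_Sup_iff by (auto intro: order_trans less_imp_le)
    moreover have "x < Sup ?D" if "x \<in> ?D" for x
      using that False Sup_upper[OF that] by (metis (no_types, lifting) order_le_less)
    ultimately show ?thesis by blast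
  qed
  then show "{x \<in> space borel. f x \<le> y} \<in> sets borel"
    by (metis (no_types, lifting) UNIV_I atMost_borel lessThan_borel space_borel Collect_cong)
qed

section \<open>Decreasing rearrangements\<close>

lemma superlevel_set_lebesgue:
  fixes u :: "'a::euclidean_space \<Rightarrow> ennreal"
  assumes "u \<in> borel_measurable lebesgue"
  shows "{x. c < u x} \<in> sets lebesgue"
proof -
  have "u -` {c<..} \<inter> space lebesgue \<in> sets lebesgue"
    using assms by (rule measurable_sets) simp
  moreover have "u -` {c<..} \<inter> space lebesgue = {x. c < u x}"
    by auto
  ultimately show ?thesis by simp
qed

text \<open>These are the distribution function and the decreasing rearrangement for
  \<open>ennreal\<close>-valued functions on the whole space. A function on \<open>\<Omega>\<close>
  enters as its absolute value extended by zero, so that no signs or domains have to be carried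
  along.\<close>

definition tail_measure :: "('a::euclidean_space \<Rightarrow> ennreal) \<Rightarrow> real \<Rightarrow> ennreal" where
  "tail_measure u s = emeasure lebesgue {x. ennreal s < u x}"

definition rearr :: "('a::euclidean_space \<Rightarrow> ennreal) \<Rightarrow> real \<Rightarrow> ennreal" where
  "rearr u t = Sup {ennreal s |s. 0 \<le> s \<and> ennreal t < tail_measure u s}"

lemma tail_measure_antimono:
  assumes "u \<in> borel_measurable lebesgue" "s \<le> s'"
  shows "tail_measure u s' \<le> tail_measure u s"
proof -
  have "{x. ennreal s < u x} \<in> sets lebesgue"
    using assms(1) by (rule superlevel_set_lebesgue)
  then show ?thesis
    unfolding tail_measure_def
    using assms(2) by (intro emeasure_mono) (auto intro: le_less_trans ennreal_leI)
qed

lemma tail_measure_mono: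
  assumes "v \<in> borel_measurable lebesgue" "\<And>x. u x \<le> v x"
  shows "tail_measure u s \<le> tail_measure v s"
proof -
  have "{x. ennreal s < v x} \<in> sets lebesgue"
    using assms(1) by (rule superlevel_set_lebesgue)
  then show ?thesis
    unfolding tail_measure_def
    using assms(2) by (intro emeasure_mono) (auto intro: less_le_trans)
qed

text \<open>Continuity from below of the measure. It allows an inequality at height \<open>s\<close>
  to be moved to a slightly larger height.\<close>

lemma tail_measure_right_continuous:
  assumes "u \<in> borel_measurable lebesgue" "0 \<le> s"
  shows "(SUP n. tail_measure u (s + 1 / real (Suc n))) = tail_measure u s"
proof -
  let ?A = "\<lambda>n. {x. ennreal (s + 1 / real (Suc n)) < u x}"
  have "incseq ?A"
  proof (rule incseq_SucI)
    fix n
    have "ennreal (s + 1 / real (Suc (Suc n))) \<le> ennreal (s + 1 / real (Suc n))"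
      by (intro ennreal_leI add_left_mono divide_left_mono) auto
    then show "?A n \<subseteq> ?A (Suc n)"
      by (auto intro: le_less_trans)
  qed
  moreover have "range ?A \<subseteq> sets lebesgue"
    using assms(1) by (blast intro: superlevel_set_lebesgue)
  ultimately have "(SUP n. emeasure lebesgue (?A n)) = emeasure lebesgue (\<Union>n. ?A n)"
    by (rule SUP_emeasure_incseq[rotated])
  moreover have "(\<Union>n. ?A n) = {x. ennreal s < u x}"
  proof (safe)
    fix x n assume "ennreal (s + 1 / real (Suc n)) < u x"
    then show "ennreal s < u x"
      by (rule le_less_trans[rotated]) (auto intro!: ennreal_leI)
  next
    fix x assume "ennreal s < u x"
    then obtain q where q: "ennreal s < q" "q < u x"
      using dense by blast
    then obtain r where r: "q = ennreal r" "0 \<le> r"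
      by (cases q) auto
    then have "s < r"
      using q assms(2) by (simp add: ennreal_less_iff)
    then obtain n where "1 / real (Suc n) < r - s"
      using nat_approx_posE[of "r - s"] by auto
    then have "ennreal (s + 1 / real (Suc n)) < u x"
      using q r by (intro le_less_trans[OF _ q(2)]) (auto intro!: ennreal_leI)
    then show "x \<in> (\<Union>n. ?A n)"
      by blast
  qed
  ultimately show ?thesis
    by (simp add: tail_measure_def)
qed

text \<open>\<open>rearr u\<close> is the generalized inverse of \<open>tail_measure u\<close>. The
  strict inequalities rest on right continuity: the height \<open>s\<close> itself would only give
  \<open>ennreal s \<le> rearr u t\<close>, while a slightly larger admissible height gives
  strictness.\<close>

lemma less_rearr_iff:
  assumes "u \<in> borel_measurable lebesgue" "0 \<le> s"
  shows "ennreal s < rearr u t \<longleftrightarrow> ennreal t < tail_measure u s"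
proof
  assume "ennreal s < rearr u t"
  then obtain s' where "0 \<le> s'" "ennreal t < tail_measure u s'" "ennreal s < ennreal s'"
    unfolding rearr_def less_Sup_iff by blast
  then show "ennreal t < tail_measure u s"
    using tail_measure_antimono[OF assms(1), of s s'] assms(2)
    by (auto simp: ennreal_less_iff intro: less_le_trans)
next
  assume "ennreal t < tail_measure u s"
  then obtain n where n: "ennreal t < tail_measure u (s + 1 / real (Suc n))"
    using tail_measure_right_continuous[OF assms, symmetric] by (auto simp: less_SUP_iff)
  have "ennreal s < ennreal (s + 1 / real (Suc n))"
    using assms(2) by (simp add: ennreal_less_iff)
  also have "\<dots> \<le> rearr u t"
    unfolding rearr_def using n assms(2) by (intro Sup_upper CollectI exI[of _ "s + 1 / real (Suc n)"]) auto
  finally show "ennreal s < rearr u t" .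
qed

lemma antimono_rearr: "antimono (rearr u)"
proof (rule antimonoI)
  fix t t' :: real assume "t \<le> t'"
  then have "ennreal t \<le> ennreal t'" by (rule ennreal_leI)
  then show "rearr u t' \<le> rearr u t"
    unfolding rearr_def by (intro Sup_subset_mono) (auto intro: le_less_trans)
qed

lemma borel_measurable_rearr [measurable]: "rearr u \<in> borel_measurable borel"
  by (rule borel_measurable_antimono_real[OF antimono_rearr])

lemma ennreal_le_of_real_less:
  fixes a b :: ennreal
  assumes "\<And>s. 0 \<le> s \<Longrightarrow> ennreal s < a \<Longrightarrow> ennreal s \<le> b"
  shows "a \<le> b"
proof (rule dense_le)
  fix y assume "y < a"
  then show "y \<le> b"
    using assms by (cases y) auto
qed

lemma rearr_mono:
  assumes "v \<in> borel_measurable lebesgue" "\<And>x. u x \<le> v x"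
  shows "rearr u t \<le> rearr v t"
  unfolding rearr_def using tail_measure_mono[OF assms]
  by (intro Sup_subset_mono) (auto intro: less_le_trans)

lemma rearr_eqI:
  assumes "\<And>s. 0 \<le> s \<Longrightarrow> tail_measure u s = tail_measure v s"
  shows "rearr u = rearr v"
  using assms by (auto simp: rearr_def fun_eq_iff intro!: arg_cong[where f=Sup])

text \<open>The measure of \<open>A\<close> has to exceed \<open>t\<close> strictly: the indicator
  of a set of measure exactly \<open>t\<close> has rearrangement 0 at \<open>t\<close>.\<close>

lemma le_rearr:
  assumes "u \<in> borel_measurable lebesgue"
    and "A \<in> sets lebesgue" "ennreal t < emeasure lebesgue A" "\<And>x. x \<in> A \<Longrightarrow> b \<le> u x"
  shows "b \<le> rearr u t"
proof (rule ennreal_le_of_real_less)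
  fix s :: real assume s: "0 \<le> s" "ennreal s < b"
  have "{x. ennreal s < u x} \<in> sets lebesgue"
    using assms(1) by (rule superlevel_set_lebesgue)
  then have "emeasure lebesgue A \<le> tail_measure u s"
    unfolding tail_measure_def using assms(4) s by (intro emeasure_mono) (auto intro: less_le_trans)
  then show "ennreal s \<le> rearr u t"
    using less_rearr_iff[OF assms(1) s(1), of t] assms(3) by (auto intro: less_imp_le less_le_trans)
qed

text \<open>Heights above \<open>b\<close> are exceeded only inside \<open>A\<close>, whose measure
  is too small for them to count at \<open>t\<close>. The set may be chosen for this
  \<open>t\<close> alone, which is what a weak type estimate supplies.\<close>

lemma rearr_le:
  assumes "u \<in> borel_measurable lebesgue"
    and "A \<in> sets lebesgue" "emeasure lebesgue A \<le> ennreal t" "\<And>x. x \<notin> A \<Longrightarrow> u x \<le> b"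
  shows "rearr u t \<le> b"
proof (rule ennreal_le_of_real_less)
  fix s :: real assume s: "0 \<le> s" "ennreal s < rearr u t"
  then have "ennreal t < tail_measure u s"
    using less_rearr_iff[OF assms(1)] by simp
  then have "\<not> {x. ennreal s < u x} \<subseteq> A"
    using assms(2,3) emeasure_mono[of "{x. ennreal s < u x}" A lebesgue]
    unfolding tail_measure_def by (meson leD order_trans)
  then show "ennreal s \<le> b"
    using assms(4) by (force intro: less_imp_le less_le_trans)
qed

section \<open>The layer cake formula and the Hardy-Littlewood inequality\<close>

lemma emeasure_lborel_Ioi: "emeasure lborel {a::real<..} = \<infinity>"
proof (rule ccontr)
  assume "emeasure lborel {a<..} \<noteq> \<infinity>"
  then obtain n where n: "emeasure lborel {a<..} < of_nat n"
    using ennreal_Ex_less_of_nat by (auto simp: less_top)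
  have "emeasure lborel {a<..<a + real n} \<le> emeasure lborel {a<..}"
    by (intro emeasure_mono) auto
  with n show False by (simp add: ennreal_of_nat_eq_real_of_nat)
qed

text \<open>Any value in \<open>ennreal\<close> becomes the length of an interval starting at 0.
  This turns \<open>u x\<close> into an integral over heights, and a measure into that of a set of
  rearrangement points.\<close>

lemma emeasure_less_ennreal:
  "emeasure lborel {s::real. 0 < s \<and> ennreal s < a} = a"
proof (cases a)
  case (real r)
  then have "{s::real. 0 < s \<and> ennreal s < a} = {0<..<r}"
    by (auto simp: ennreal_less_iff)
  then show ?thesis using real by simp
next
  case top
  then have "{s::real. 0 < s \<and> ennreal s < a} = {0<..}"
    by auto
  then show ?thesis using top
    by (auto simp: emeasure_lborel_Ioi)
qed

text \<open>Tonelli for the region \<open>0 < s < u x\<close> under the graph.\<close>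

lemma layer_cake_lborel:
  fixes u :: "'a::euclidean_space \<Rightarrow> ennreal"
  assumes [measurable]: "u \<in> borel_measurable borel"
  shows "(\<integral>\<^sup>+x. u x \<partial>lborel) = (\<integral>\<^sup>+s\<in>{0<..}. emeasure lborel {x. ennreal s < u x} \<partial>lborel)"
proof -
  let ?g = "\<lambda>(x, s). indicator {s. 0 < s \<and> ennreal s < u x} s :: ennreal"
  have [measurable]: "?g \<in> borel_measurable (lborel \<Otimes>\<^sub>M lborel)"
    by measurable
  have "(\<integral>\<^sup>+x. u x \<partial>lborel) = (\<integral>\<^sup>+x. (\<integral>\<^sup>+s. ?g (x, s) \<partial>lborel) \<partial>lborel)"
    by (simp add: emeasure_less_ennreal)
  also have "\<dots> = (\<integral>\<^sup>+s. (\<integral>\<^sup>+x. ?g (x, s) \<partial>lborel) \<partial>lborel)"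
    using lborel_pair.Fubini'[of "\<lambda>x s. ?g (x, s)"] by simp
  also have "\<dots> = (\<integral>\<^sup>+s\<in>{0<..}. (\<integral>\<^sup>+x. indicator {x. ennreal s < u x} x \<partial>lborel) \<partial>lborel)"
    by (intro nn_integral_cong) (auto simp: indicator_def)
  also have "\<dots> = (\<integral>\<^sup>+s\<in>{0<..}. emeasure lborel {x. ennreal s < u x} \<partial>lborel)"
    by (subst nn_integral_indicator) simp_all
  finally show ?thesis .
qed

text \<open>A Borel function equal to \<open>u\<close> almost everywhere has the same integral and
  superlevel sets of the same measure.\<close>

lemma layer_cake:
  fixes u :: "'a::euclidean_space \<Rightarrow> ennreal"
  assumes u: "u \<in> borel_measurable lebesgue"
  shows "(\<integral>\<^sup>+x. u x \<partial>lebesgue) = (\<integral>\<^sup>+s\<in>{0<..}. tail_measure u s \<partial>lborel)"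
proof -
  obtain v where v [measurable]: "v \<in> borel_measurable lborel" and ae: "AE x in lborel. u x = v x"
    using completion_ex_borel_measurable[OF u] by blast
  have aeL: "AE x in lebesgue. u x = v x"
    using AE_completion[OF ae] by simp
  have "emeasure lborel {x. ennreal s < v x} = tail_measure u s" for s
  proof -
    have "{x. ennreal s < v x} \<in> sets lborel" by measurable
    then have "emeasure lborel {x. ennreal s < v x} = emeasure lebesgue {x. ennreal s < v x}"
      by simp
    also have "\<dots> = tail_measure u s"
      unfolding tail_measure_def using aeL u \<open>_ \<in> sets lborel\<close>
      by (intro emeasure_eq_AE) (auto intro: superlevel_set_lebesgue)
    finally show ?thesis .
  qed
  moreover have "(\<integral>\<^sup>+x. u x \<partial>lebesgue) = (\<integral>\<^sup>+x. v x \<partial>lborel)"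
    using ae by (simp add: nn_integral_completion cong: nn_integral_cong_AE)
  ultimately show ?thesis
    using layer_cake_lborel[of v] by simp
qed

text \<open>At height \<open>s\<close> the superlevel set within \<open>E\<close> has measure at
  most \<open>min (tail_measure u s) (ennreal m)\<close>, which is exactly the measure of the part
  of \<open>(0, m)\<close> where \<open>rearr u\<close> exceeds \<open>s\<close>. Integration over
  the heights concludes.\<close>

lemma Hardy_Littlewood:
  assumes u: "u \<in> borel_measurable lebesgue"
    and E: "E \<in> sets lebesgue" "emeasure lebesgue E \<le> ennreal m"
  shows "(\<integral>\<^sup>+x\<in>E. u x \<partial>lebesgue) \<le> (\<integral>\<^sup>+t\<in>{0<..<m}. rearr u t \<partial>lborel)"
proof -
  have mE: "(\<lambda>x. u x * indicator E x) \<in> borel_measurable lebesgue"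
    using u E by simp
  have "(\<integral>\<^sup>+x\<in>E. u x \<partial>lebesgue) = (\<integral>\<^sup>+s\<in>{0<..}. tail_measure (\<lambda>x. u x * indicator E x) s \<partial>lborel)"
    by (rule layer_cake[OF mE])
  also have "\<dots> \<le> (\<integral>\<^sup>+s\<in>{0<..}. emeasure lborel {t. ennreal s < rearr u t * indicator {0<..<m} t} \<partial>lborel)"
  proof (intro nn_integral_mono)
    fix s :: real
    show "tail_measure (\<lambda>x. u x * indicator E x) s * indicator {0<..} s \<le>
      emeasure lborel {t. ennreal s < rearr u t * indicator {0<..<m} t} * indicator {0<..} s"
    proof (cases "0 < s")
      case True
      have m: "{x. ennreal s < u x} \<in> sets lebesgue"
        using u by (rule superlevel_set_lebesgue)
      have "tail_measure (\<lambda>x. u x * indicator E x) s \<le> min (tail_measure u s) (ennreal m)"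
        unfolding tail_measure_def
        by (intro min.boundedI emeasure_mono m order_trans[OF emeasure_mono E(2)] E(1))
          (auto split: split_indicator)
      also have "\<dots> = emeasure lborel {t::real. 0 < t \<and> ennreal t < min (tail_measure u s) (ennreal m)}"
        by (simp only: emeasure_less_ennreal)
      also have "{t::real. 0 < t \<and> ennreal t < min (tail_measure u s) (ennreal m)} =
          {t. ennreal s < rearr u t * indicator {0<..<m} t}"
        using True less_rearr_iff[OF u, of s]
        by (auto simp: ennreal_less_iff split: split_indicator)
      finally show ?thesis using True by simp
    qed simp
  qed
  also have "\<dots> = (\<integral>\<^sup>+t\<in>{0<..<m}. rearr u t \<partial>lborel)"
    by (rule layer_cake_lborel[symmetric]) simp
  finally show ?thesis .
qed

text \<open>The averages of a decreasing function over \<open>(0, m)\<close> decrease in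
  \<open>m\<close>: stretching \<open>(0, t)\<close> onto \<open>(0, m)\<close> moves every point to
  the right.\<close>

lemma rearr_integral_average:
  assumes "0 < t" "t \<le> m"
  shows "(\<integral>\<^sup>+y\<in>{0<..<m}. rearr u y \<partial>lborel) \<le> ennreal (m / t) * (\<integral>\<^sup>+y\<in>{0<..<t}. rearr u y \<partial>lborel)"
proof -
  have "(\<integral>\<^sup>+y\<in>{0<..<m}. rearr u y \<partial>lborel) =
      ennreal \<bar>m / t\<bar> * (\<integral>\<^sup>+y. rearr u (0 + (m / t) * y) * indicator {0<..<m} (0 + (m / t) * y) \<partial>lborel)"
    using assms by (intro nn_integral_real_affine) auto
  also have "\<dots> \<le> ennreal (m / t) * (\<integral>\<^sup>+y\<in>{0<..<t}. rearr u y \<partial>lborel)"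
  proof (rule mult_mono[OF _ nn_integral_mono])
    fix y :: real
    show "rearr u (0 + (m / t) * y) * indicator {0<..<m} (0 + (m / t) * y)
      \<le> rearr u y * indicator {0<..<t} y"
    proof (cases "0 < y \<and> y < t")
      case True
      have "y * t \<le> y * m" using True assms by simp
      then have "y \<le> (m / t) * y" using assms by (simp add: field_simps)
      then show ?thesis
        using True antimonoD[OF antimono_rearr] by (auto split: split_indicator)
    next
      case False
      then have "0 + (m / t) * y \<notin> {0<..<m}"
        using assms by (auto simp: field_simps zero_less_divide_iff zero_less_mult_iff)
      then show ?thesis by simp
    qed
  qed (use assms in auto)
  finally show ?thesis .
qed

section \<open>The extended nonlinearity\<close>

text \<open>\<open>Lim\<close> is a mere description of a limit, so convergence has to be proved
  before the value at infinity can be identified.\<close>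

lemma Lim_ennreal_mono_on:
  assumes "mono_on {0..} \<psi>"
  shows "Lim at_top (\<lambda>s::real. ennreal (\<psi> s)) = (SUP s\<in>{0..}. ennreal (\<psi> s))"
proof (rule tendsto_Lim)
  show "((\<lambda>s. ennreal (\<psi> s)) \<longlongrightarrow> (SUP s\<in>{0..}. ennreal (\<psi> s))) at_top"
  proof (rule increasing_tendsto)
    show "\<forall>\<^sub>F s in at_top. ennreal (\<psi> s) \<le> (SUP s\<in>{0..}. ennreal (\<psi> s))"
      using eventually_ge_at_top[of 0] by eventually_elim (auto intro: SUP_upper)
  next
    fix y assume "y < (SUP s\<in>{0..}. ennreal (\<psi> s))"
    then obtain s where s: "0 \<le> s" "y < ennreal (\<psi> s)"
      unfolding less_SUP_iff by auto
    show "\<forall>\<^sub>F s in at_top. y < ennreal (\<psi> s)"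
      using eventually_ge_at_top[of s]
    proof eventually_elim
      case (elim s')
      then have "\<psi> s \<le> \<psi> s'"
        using s by (intro mono_onD[OF assms]) auto
      then show ?case
        using s(2) by (auto intro: less_le_trans ennreal_leI)
    qed
  qed
qed simp

lemma extend_at_infinity_top:
  assumes "mono_on {0..} \<psi>"
  shows "extend_at_infinity \<psi> \<infinity> = (SUP s\<in>{0..}. ennreal (\<psi> s))"
  by (simp add: extend_at_infinity_def Lim_ennreal_mono_on[OF assms])

lemma extend_at_infinity_ennreal:
  "0 \<le> s \<Longrightarrow> extend_at_infinity \<psi> (ennreal s) = ennreal (\<psi> s)"
  by (simp add: extend_at_infinity_def)

lemma mono_extend_at_infinity:
  assumes "mono_on {0..} \<psi>"
  shows "mono (extend_at_infinity \<psi>)"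
proof (rule monoI)
  fix a b :: ennreal assume ab: "a \<le> b"
  show "extend_at_infinity \<psi> a \<le> extend_at_infinity \<psi> b"
  proof (cases b)
    case (real r)
    then obtain q where "a = ennreal q" "0 \<le> q" "q \<le> r"
      using ab by (cases a) (auto simp: top_unique)
    then show ?thesis
      using real mono_onD[OF assms, of q r] by (auto simp: extend_at_infinity_ennreal intro: ennreal_leI)
  next
    case top
    then show ?thesis
      using extend_at_infinity_top[OF assms]
      by (cases a) (auto simp: extend_at_infinity_ennreal intro: SUP_upper)
  qed
qed

text \<open>For a monotone function left continuity amounts to commuting with suprema. At infinity
  this holds because the value there was chosen as the limit. Monotone convergence arguments can
  thus be carried through the nonlinearity.\<close>

lemma extend_at_infinity_SUP:
  assumes mono: "mono_on {0..} \<psi>" and left: "\<forall>s>0. continuous (at_left s) \<psi>"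
  shows "extend_at_infinity \<psi> (SUP k::nat. u k) = (SUP k. extend_at_infinity \<psi> (u k))"
proof (rule antisym)
  note P = mono_extend_at_infinity[OF mono]
  have below: "extend_at_infinity \<psi> (ennreal s) \<le> (SUP k. extend_at_infinity \<psi> (u k))"
    if less: "ennreal s < (SUP k. u k)" for s
  proof -
    obtain k where "ennreal s < u k"
      using less unfolding less_SUP_iff by auto
    then have "extend_at_infinity \<psi> (ennreal s) \<le> extend_at_infinity \<psi> (u k)"
      by (intro monoD[OF P]) simp
    also have "\<dots> \<le> (SUP k. extend_at_infinity \<psi> (u k))"
      by (rule SUP_upper) simp
    finally show ?thesis .
  qed
  show "extend_at_infinity \<psi> (SUP k. u k) \<le> (SUP k. extend_at_infinity \<psi> (u k))"
  proof (cases "SUP k. u k")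
    case top
    have "(SUP s\<in>{0..}. ennreal (\<psi> s)) \<le> (SUP k. extend_at_infinity \<psi> (u k))"
    proof (rule SUP_least)
      fix s :: real assume "s \<in> {0..}"
      then show "ennreal (\<psi> s) \<le> (SUP k. extend_at_infinity \<psi> (u k))"
        using below[of s] top by (simp add: extend_at_infinity_ennreal)
    qed
    then show ?thesis
      using extend_at_infinity_top[OF mono] unfolding top by simp
  next
    case (real a)
    show ?thesis
    proof (cases "a = 0")
      \<comment> \<open>Left continuity is assumed at positive points only; at 0 all
        \<open>u k\<close> vanish, so the supremum is attained.\<close>
      case True
      then have "u 0 = 0"
        using real by (metis SUP_upper UNIV_I ennreal_0 le_zero_eq)
      then show ?thesis
        using real True by (auto intro: SUP_upper2[of 0])
    next
      case False
      then have "0 < a" using real by simp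
      show ?thesis
      proof (rule dense_le)
        fix y assume "y < extend_at_infinity \<psi> (SUP k. u k)"
        then have y: "y < ennreal (\<psi> a)"
          using real by (simp add: extend_at_infinity_ennreal)
        have "((\<lambda>s. ennreal (\<psi> s)) \<longlongrightarrow> ennreal (\<psi> a)) (at_left a)"
          using left \<open>0 < a\<close> by (intro tendsto_ennrealI) (auto simp: continuous_within)
        then have "\<forall>\<^sub>F s in at_left a. y < ennreal (\<psi> s)"
          using y by (rule order_tendstoD)
        moreover have "\<forall>\<^sub>F s in at_left a. s \<in> {0<..<a}"
          using \<open>0 < a\<close> by (rule eventually_at_left_real)
        ultimately have "\<exists>s. y < ennreal (\<psi> s) \<and> s \<in> {0<..<a}"
          by (rule eventually_happens'[OF trivial_limit_at_left_real eventually_conj])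
        then obtain s where s: "y < ennreal (\<psi> s)" "0 < s" "s < a"
          by auto
        then have "extend_at_infinity \<psi> (ennreal s) \<le> (SUP k. extend_at_infinity \<psi> (u k))"
          using real by (intro below) (simp add: ennreal_less_iff)
        with s show "y \<le> (SUP k. extend_at_infinity \<psi> (u k))"
          by (auto simp: extend_at_infinity_ennreal)
      qed
    qed
  qed
  show "(SUP k. extend_at_infinity \<psi> (u k)) \<le> extend_at_infinity \<psi> (SUP k. u k)"
    by (intro SUP_least monoD[OF P] SUP_upper) simp
qed

section \<open>Power substitutions\<close>

lemma nn_integral_exhaust:
  fixes f :: "'a \<Rightarrow> ennreal"
  assumes f: "f \<in> borel_measurable M" and S: "\<And>N::nat. S N \<in> sets M" "\<And>N. S N \<subseteq> S (Suc N)"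
  shows "(\<integral>\<^sup>+x\<in>(\<Union>N. S N). f x \<partial>M) = (SUP N. \<integral>\<^sup>+x\<in>S N. f x \<partial>M)"
proof -
  have "(\<integral>\<^sup>+x\<in>(\<Union>N. S N). f x \<partial>M) = (\<integral>\<^sup>+x. (SUP N. f x * indicator (S N) x) \<partial>M)"
  proof (intro nn_integral_cong antisym)
    fix x
    show "f x * indicator (\<Union>N. S N) x \<le> (SUP N. f x * indicator (S N) x)"
    proof (cases "x \<in> (\<Union>N. S N)")
      case True
      then obtain K where "x \<in> S K" by blast
      then show ?thesis by (intro SUP_upper2[of K]) (auto simp: indicator_def)
    qed simp
    show "(SUP N. f x * indicator (S N) x) \<le> f x * indicator (\<Union>N. S N) x"
      by (intro SUP_least) (auto simp: indicator_def)
  qed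
  also have "\<dots> = (SUP N. \<integral>\<^sup>+x\<in>S N. f x \<partial>M)"
  proof (rule nn_integral_monotone_convergence_SUP)
    show "incseq (\<lambda>N x. f x * indicator (S N) x)"
      using S(2) by (intro incseq_SucI) (auto simp: le_fun_def indicator_def)
    show "(\<lambda>x. f x * indicator (S N) x) \<in> borel_measurable M" for N
      using f S(1) by simp
  qed
  finally show ?thesis .
qed

text \<open>The derivative of \<open>\<kappa> * s powr p\<close> may blow up at 0 and the range is
  unbounded, so the substitution is made on compact intervals inside \<open>{t<..}\<close> and
  passed to the limit by monotone convergence.\<close>

lemma nn_integral_powr_substitution:
  fixes h :: "real \<Rightarrow> ennreal"
  assumes h [measurable]: "h \<in> borel_measurable borel" and pos: "0 < \<kappa>" "0 < p" and t: "0 \<le> t"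
  shows "(\<integral>\<^sup>+r\<in>{\<kappa> * t powr p<..}. h r \<partial>lborel) =
    (\<integral>\<^sup>+s\<in>{t<..}. ennreal (\<kappa> * p * s powr (p - 1)) * h (\<kappa> * s powr p) \<partial>lborel)"
proof -
  \<comment> \<open>\<open>a N\<close> decreases to \<open>t\<close> without reaching it; the
    summand 2 in \<open>b N\<close> keeps \<open>a N < b N\<close> already for
    \<open>N = 0\<close>.\<close>
  define a b where "a N = t + 1 / real (Suc N)" and "b N = t + 2 + real N" for N
  define g where "g s = \<kappa> * s powr p" for s
  have ab: "t < a N" "a N < b N" "a (Suc N) \<le> a N" "b N \<le> b (Suc N)" for N
  proof -
    have "1 / real (Suc N) < 2 + real N" "1 / real (Suc (Suc N)) \<le> 1 / real (Suc N)"
      by (simp_all add: divide_simps algebra_simps add_pos_nonneg)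
    then show "t < a N" "a N < b N" "a (Suc N) \<le> a N" "b N \<le> b (Suc N)"
      by (auto simp: a_def b_def)
  qed
  have g_mono: "g s \<le> g s'" if "0 \<le> s" "s \<le> s'" for s s'
    using that pos by (auto simp: g_def intro: powr_mono2)
  have g_strict: "g s < g s'" if "0 \<le> s" "s < s'" for s s'
    using that pos by (auto simp: g_def intro: powr_less_mono2)
  have ex: "\<exists>N. a N \<le> s \<and> s \<le> b N" if "t < s" for s
  proof -
    obtain N where N: "1 / real (Suc N) < s - t"
      using nat_approx_posE[of "s - t"] \<open>t < s\<close> by auto
    obtain M where M: "s - t < real M"
      using reals_Archimedean2 by blast
    have "1 / real (Suc (max N M)) \<le> 1 / real (Suc N)"
      by (intro divide_left_mono) auto
    with N M have "a (max N M) \<le> s \<and> s \<le> b (max N M)"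
      by (auto simp: a_def b_def)
    then show ?thesis ..
  qed
  have inc: "{a N..b N} \<subseteq> {a (Suc N)..b (Suc N)}" "{g (a N)..g (b N)} \<subseteq> {g (a (Suc N))..g (b (Suc N))}" for N
    using ab[of N] ab[of "Suc N"] t by (auto intro: order_trans g_mono)
  have un: "(\<Union>N. {a N..b N}) = {t<..}"
    using ab(1) ex by (force intro: less_le_trans)
  have un': "(\<Union>N. {g (a N)..g (b N)}) = {g t<..}"
  proof (intro set_eqI iffI)
    fix r assume "r \<in> (\<Union>N. {g (a N)..g (b N)})"
    then obtain N where "g (a N) \<le> r" by auto
    then show "r \<in> {g t<..}"
      using g_strict[OF t ab(1)[of N]] by auto
  next
    fix r assume r: "r \<in> {g t<..}"
    define s where "s = (r / \<kappa>) powr (1 / p)"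
    have "0 \<le> g t" using pos by (simp add: g_def)
    then have "0 < r" using r by simp
    then have gs: "g s = r"
      using pos by (simp add: g_def s_def powr_powr)
    have "t < s"
    proof (rule ccontr)
      assume "\<not> t < s"
      then have "g s \<le> g t" by (intro g_mono) (auto simp: s_def)
      then show False using gs r by simp
    qed
    then obtain N where "a N \<le> s" "s \<le> b N"
      using ex by blast
    then show "r \<in> (\<Union>N. {g (a N)..g (b N)})"
      using g_mono[of "a N" s] g_mono[of s "b N"] gs ab(1)[of N] t \<open>t < s\<close> by auto
  qed
  have sub: "(\<integral>\<^sup>+r\<in>{g (a N)..g (b N)}. h r \<partial>lborel) =
      (\<integral>\<^sup>+s\<in>{a N..b N}. ennreal (\<kappa> * p * s powr (p - 1)) * h (g s) \<partial>lborel)" for N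
  proof -
    have "(\<integral>\<^sup>+r\<in>{g (a N)..g (b N)}. h r \<partial>lborel) =
      (\<integral>\<^sup>+s. h (g s) * ennreal (\<kappa> * p * s powr (p - 1)) * indicator {a N..b N} s \<partial>lborel)"
    proof (rule nn_integral_substitution_aux)
      fix s assume "s \<in> {a N..b N}"
      then have "0 < s" using ab(1)[of N] t by auto
      then show "(g has_real_derivative \<kappa> * p * s powr (p - 1)) (at s)"
        unfolding g_def by (auto intro!: derivative_eq_intros)
    next
      show "continuous_on {a N..b N} (\<lambda>s. \<kappa> * p * s powr (p - 1))"
        using ab(1)[of N] t by (auto intro!: continuous_intros)
    qed (use ab pos in auto)
    then show ?thesis by (simp add: mult.commute)
  qed
  have "(\<integral>\<^sup>+r\<in>{g t<..}. h r \<partial>lborel) =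
    (\<integral>\<^sup>+s\<in>{t<..}. ennreal (\<kappa> * p * s powr (p - 1)) * h (g s) \<partial>lborel)"
  proof -
    have [measurable]: "g \<in> borel_measurable borel"
      unfolding g_def by measurable
    have "(\<integral>\<^sup>+r\<in>(\<Union>N. {g (a N)..g (b N)}). h r \<partial>lborel) = (SUP N. \<integral>\<^sup>+r\<in>{g (a N)..g (b N)}. h r \<partial>lborel)"
    proof (rule nn_integral_exhaust)
      show "{g (a N)..g (b N)} \<subseteq> {g (a (Suc N))..g (b (Suc N))}" for N by (rule inc)
    qed auto
    also have "\<dots> = (\<integral>\<^sup>+s\<in>(\<Union>N. {a N..b N}). ennreal (\<kappa> * p * s powr (p - 1)) * h (g s) \<partial>lborel)"
      unfolding sub
    proof (rule nn_integral_exhaust[symmetric])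
      show "{a N..b N} \<subseteq> {a (Suc N)..b (Suc N)}" for N by (rule inc)
    qed auto
    finally show ?thesis unfolding un un' .
  qed
  then show ?thesis by (simp add: g_def)
qed

text \<open>Substituting \<open>r powr \<alpha>\<close> turns the integral into the length of
  \<open>(0, \<rho> powr \<alpha>]\<close>, also when \<open>\<alpha> < 1\<close> makes the
  integrand singular at 0.\<close>

lemma nn_integral_powr_Ioc:
  assumes "0 < \<alpha>" "0 < \<rho>"
  shows "(\<integral>\<^sup>+r\<in>{0<..\<rho>}. ennreal (r powr (\<alpha> - 1)) \<partial>lborel) = ennreal (\<rho> powr \<alpha> / \<alpha>)"
proof -
  have iff: "s powr \<alpha> \<le> \<rho> powr \<alpha> \<longleftrightarrow> s \<le> \<rho>" if "0 < s" for s
    using that assms powr_mono2[of \<alpha> s \<rho>] powr_less_mono2[of \<alpha> \<rho> s] by force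
  have "ennreal (\<rho> powr \<alpha>) = (\<integral>\<^sup>+r\<in>{1 * 0 powr \<alpha><..}. indicator {..\<rho> powr \<alpha>} r \<partial>lborel)"
  proof -
    have "{..\<rho> powr \<alpha>} \<inter> {0<..} = {0<..\<rho> powr \<alpha>}" by auto
    then show ?thesis by (simp flip: indicator_inter_arith)
  qed
  also have "\<dots> = (\<integral>\<^sup>+s\<in>{0<..}. ennreal (1 * \<alpha> * s powr (\<alpha> - 1)) * indicator {..\<rho> powr \<alpha>} (1 * s powr \<alpha>) \<partial>lborel)"
    using assms by (intro nn_integral_powr_substitution) auto
  also have "\<dots> = (\<integral>\<^sup>+s. ennreal \<alpha> * (ennreal (s powr (\<alpha> - 1)) * indicator {0<..\<rho>} s) \<partial>lborel)"
    using assms iff by (intro nn_integral_cong) (auto simp: indicator_def ennreal_mult)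
  also have "\<dots> = ennreal \<alpha> * (\<integral>\<^sup>+r\<in>{0<..\<rho>}. ennreal (r powr (\<alpha> - 1)) \<partial>lborel)"
    by (rule nn_integral_cmult) simp
  finally have "ennreal (1 / \<alpha>) * ennreal (\<rho> powr \<alpha>) =
      ennreal (1 / \<alpha>) * ennreal \<alpha> * (\<integral>\<^sup>+r\<in>{0<..\<rho>}. ennreal (r powr (\<alpha> - 1)) \<partial>lborel)"
    by (simp add: mult.assoc)
  then show ?thesis
    using assms by (simp flip: ennreal_mult)
qed

section \<open>Weak type bound for ball averages\<close>

text \<open>The strict inequalities force \<open>a\<close> and \<open>c\<close> to be finite, so no
  infinite summand on the left can absorb the gain.\<close>

lemma ennreal_add_strict_mono:
  fixes a b c d :: ennreal
  assumes "a < b" "c < d"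
  shows "a + c < b + d"
  using assms by (cases a; cases b; cases c; cases d)
    (auto simp: ennreal_less_iff simp flip: ennreal_plus)

lemma ennreal_sum_strict_mono:
  fixes f g :: "'b \<Rightarrow> ennreal"
  assumes "finite A" "A \<noteq> {}" "\<And>i. i \<in> A \<Longrightarrow> f i < g i"
  shows "sum f A < sum g A"
  using assms by (induction rule: finite_ne_induct) (auto intro: ennreal_add_strict_mono)

text \<open>Lindelof and continuity from below reduce a union to its finite subfamilies. For
  finitely many balls the radii are bounded, as the Vitali covering lemma requires.\<close>

lemma emeasure_Union_le_of_finite:
  fixes \<F> :: "'a::euclidean_space set set"
  assumes op: "\<And>S. S \<in> \<F> \<Longrightarrow> open S"
    and fin: "\<And>K. finite K \<Longrightarrow> K \<subseteq> \<F> \<Longrightarrow> emeasure lborel (\<Union>K) \<le> c"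
  shows "emeasure lborel (\<Union>\<F>) \<le> c"
proof -
  obtain \<F>' where F': "\<F>' \<subseteq> \<F>" "countable \<F>'" "\<Union>\<F>' = \<Union>\<F>"
    using Lindelof[of \<F>] op by auto
  show ?thesis
  proof (cases "\<F>' = {}")
    case True
    then have "\<Union>\<F> = {}" using F' by auto
    then show ?thesis by (metis emeasure_empty zero_le)
  next
    case False
    let ?S = "\<lambda>k. \<Union>(from_nat_into \<F>' ` {..k})"
    have sub: "from_nat_into \<F>' ` {..k} \<subseteq> \<F>" for k
      using from_nat_into[OF False] F'(1) by auto
    have "(\<Union>k. ?S k) = \<Union>(range (from_nat_into \<F>'))"
      by auto
    then have "(\<Union>k. ?S k) = \<Union>\<F>"
      using range_from_nat_into[OF False F'(2)] F'(3) by simp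
    moreover have "(SUP k. emeasure lborel (?S k)) = emeasure lborel (\<Union>k. ?S k)"
    proof (rule SUP_emeasure_incseq)
      show "range ?S \<subseteq> sets lborel"
        using sub op by (fastforce intro!: borel_open)
      show "incseq ?S"
        by (rule incseq_SucI) force
    qed
    ultimately show ?thesis
      using fin[OF _ sub] by (metis (no_types, lifting) SUP_least finite_atMost finite_imageI)
  qed
qed

lemma emeasure_ball_eq:
  fixes x :: "'a::euclidean_space"
  assumes "0 \<le> r"
  shows "emeasure lebesgue (ball x r) = ennreal (unit_ball_vol (DIM('a)) * r ^ DIM('a))"
  using emeasure_ball[OF assms, of x] by simp

text \<open>A superlevel set of the uncentred maximal function over balls. Collecting whole balls
  makes it open, hence measurable, and it still contains every centre.\<close>

definition mean_exceeds :: "('a::euclidean_space \<Rightarrow> ennreal) \<Rightarrow> ennreal \<Rightarrow> 'a set" where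
  "mean_exceeds u c = \<Union>{ball x r |x r. 0 < r \<and> c * emeasure lebesgue (ball x r) < (\<integral>\<^sup>+y\<in>ball x r. u y \<partial>lebesgue)}"

text \<open>Suppose that finitely many of the balls cover more than \<open>t\<close>. Vitali selects
  disjoint ones of total measure \<open>m\<close> with \<open>t < 5 ^ DIM('a) * m\<close>. Summing
  their averages makes the integral of \<open>u\<close> over them exceed \<open>m\<close> times the
  threshold, while Hardy-Littlewood bounds it by the integral of \<open>rearr u\<close> over
  \<open>(0, m)\<close>.\<close>

lemma mean_exceeds_weak_type:
  fixes u :: "'a::euclidean_space \<Rightarrow> ennreal"
  assumes u: "u \<in> borel_measurable lebesgue" and t: "0 < t"
  shows "emeasure lborel (mean_exceeds u (ennreal (5 ^ DIM('a) / t) * (\<integral>\<^sup>+y\<in>{0<..<t}. rearr u y \<partial>lborel))) \<le> ennreal t"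
  unfolding mean_exceeds_def
proof (rule emeasure_Union_le_of_finite)
  define F where "F m = (\<integral>\<^sup>+y\<in>{0<..<m}. rearr u y \<partial>lborel)" for m
  let ?c = "ennreal (5 ^ DIM('a) / t) * F t"
  let ?\<F> = "{ball x r |x r. 0 < r \<and> ?c * emeasure lebesgue (ball x r) < (\<integral>\<^sup>+y\<in>ball x r. u y \<partial>lebesgue)}"
  show "open S" if "S \<in> {ball x r |x r. 0 < r \<and> ennreal (5 ^ DIM('a) / t) * (\<integral>\<^sup>+y\<in>{0<..<t}. rearr u y \<partial>lborel) *
     emeasure lebesgue (ball x r) < (\<integral>\<^sup>+y\<in>ball x r. u y \<partial>lebesgue)}" for S
    using that by auto
  fix K assume "finite K" "K \<subseteq> {ball x r |x r. 0 < r \<and> ennreal (5 ^ DIM('a) / t) * (\<integral>\<^sup>+y\<in>{0<..<t}. rearr u y \<partial>lborel) *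
     emeasure lebesgue (ball x r) < (\<integral>\<^sup>+y\<in>ball x r. u y \<partial>lebesgue)}"
  then have K: "finite K" "K \<subseteq> ?\<F>" by (auto simp: F_def)
  then have "\<forall>S\<in>K. \<exists>x r. S = ball x r \<and> 0 < r \<and> ?c * emeasure lebesgue S < (\<integral>\<^sup>+y\<in>S. u y \<partial>lebesgue)"
    by blast
  then obtain a r where ar: "\<And>S. S \<in> K \<Longrightarrow> S = ball (a S) (r S) \<and> 0 < r S \<and>
      ?c * emeasure lebesgue S < (\<integral>\<^sup>+y\<in>S. u y \<partial>lebesgue)"
    by metis
  have "\<exists>B. \<forall>S\<in>K. r S \<le> B"
    using K(1) by (metis finite_imageI image_eqI Max_ge)
  then obtain B where B: "\<And>S. S \<in> K \<Longrightarrow> r S \<le> B" by blast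
  obtain C where C: "C \<subseteq> K" "pairwise (\<lambda>i j. disjnt (ball (a i) (r i)) (ball (a j) (r j))) C"
     "\<Union>K \<subseteq> (\<Union>i\<in>C. ball (a i) (5 * r i))"
    using ar B by (rule_tac Vitali_covering_lemma_balls[where S="\<Union>K" and K=K and a=a and r=r and B=B]) auto
  have finC: "finite C" using C(1) K(1) by (rule finite_subset)
  have disj: "disjoint_family_on (\<lambda>S. S) C"
    using C(2) ar C(1) unfolding disjoint_family_on_def pairwise_def disjnt_def by (metis subsetD)
  have setsC: "S \<in> sets lebesgue" if "S \<in> C" for S
  proof -
    have "S = ball (a S) (r S)" using that C(1) ar by blast
    then show ?thesis by (metis fmeasurableD lmeasurable_ball)
  qed
  define \<omega> where "\<omega> = unit_ball_vol (real DIM('a))"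
  have \<omega>: "0 < \<omega>" by (simp add: \<omega>_def)
  have em: "emeasure lebesgue S = ennreal (\<omega> * r S ^ DIM('a))" if "S \<in> C" for S
    proof -
    have "S = ball (a S) (r S)" "0 < r S" using that C(1) ar by blast+
    then show ?thesis using emeasure_ball_eq[of "r S" "a S"] unfolding \<omega>_def by simp
  qed
  define m where "m = (\<Sum>S\<in>C. \<omega> * r S ^ DIM('a))"
  have rpos: "0 < r S" if "S \<in> C" for S using that C(1) ar by blast
  have sum_em: "(\<Sum>S\<in>C. emeasure lebesgue S) = ennreal m"
    using em \<omega> rpos by (simp add: m_def less_imp_le flip: sum_ennreal)
  show "emeasure lborel (\<Union>K) \<le> ennreal t"
  proof (rule ccontr)
    assume "\<not> emeasure lborel (\<Union>K) \<le> ennreal t"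
    then have "ennreal t < emeasure lborel (\<Union>K)" by simp
    also have "\<dots> \<le> emeasure lborel (\<Union>i\<in>C. ball (a i) (5 * r i))"
      using C(3) by (intro emeasure_mono) (auto intro!: borel_open open_UN)
    also have "\<dots> \<le> (\<Sum>i\<in>C. emeasure lborel (ball (a i) (5 * r i)))"
      using finC by (intro emeasure_subadditive_finite) auto
    also have "\<dots> = (\<Sum>i\<in>C. ennreal (5 ^ DIM('a) * (\<omega> * r i ^ DIM('a))))"
      using rpos by (intro sum.cong) (auto simp: emeasure_ball \<omega>_def power_mult_distrib mult_ac less_imp_le)
    also have "\<dots> = ennreal (5 ^ DIM('a) * m)"
      using \<omega> rpos by (subst sum_ennreal) (auto simp: m_def less_imp_le sum_distrib_left)
    finally have tm: "t < 5 ^ DIM('a) * m"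
      using t by (simp add: ennreal_less_iff)
    then have m: "0 < m" using t by (metis less_trans zero_less_mult_pos zero_less_numeral zero_less_power)
    then have "C \<noteq> {}" by (auto simp: m_def)
    have "?c * ennreal m = (\<Sum>S\<in>C. ?c * emeasure lebesgue S)"
      by (simp add: sum_em flip: sum_distrib_left)
    also have "\<dots> < (\<Sum>S\<in>C. \<integral>\<^sup>+y\<in>S. u y \<partial>lebesgue)"
      using ar C(1) by (intro ennreal_sum_strict_mono finC \<open>C \<noteq> {}\<close>) blast
    also have "\<dots> = (\<Sum>S\<in>C. emeasure (density lebesgue u) S)"
      using u setsC by (intro sum.cong) (auto simp: emeasure_density)
    also have "\<dots> = emeasure (density lebesgue u) (\<Union>S\<in>C. S)"
      using setsC finC disj by (intro sum_emeasure) auto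
    also have "\<dots> = (\<integral>\<^sup>+y\<in>(\<Union>S\<in>C. S). u y \<partial>lebesgue)"
      using u setsC finC by (intro emeasure_density) auto
    also have "\<dots> \<le> F m"
      unfolding F_def
    proof (rule Hardy_Littlewood[OF u])
      show "(\<Union>S\<in>C. S) \<in> sets lebesgue" using setsC finC by auto
      have "emeasure lebesgue (\<Union>S\<in>C. S) \<le> (\<Sum>S\<in>C. emeasure lebesgue S)"
        using setsC finC by (intro emeasure_subadditive_finite) auto
      then show "emeasure lebesgue (\<Union>S\<in>C. S) \<le> ennreal m"
        by (simp add: sum_em)
    qed
    finally have "?c * ennreal m < F m" .
    have cm: "ennreal (5 ^ DIM('a) / t * m) = ennreal (5 ^ DIM('a) / t) * ennreal m"
      using t m by (intro ennreal_mult) auto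
    \<comment> \<open>For \<open>t \<le> m\<close> the averages of the rearrangement decrease; for
      \<open>m < t\<close> the integral is monotone and \<open>t < 5 ^ DIM('a) * m\<close> makes the
      factor at least 1. The Vitali constant is spent only in the second case.\<close>
    have "F m \<le> ?c * ennreal m"
    proof (cases "t \<le> m")
      case True
      have "F m \<le> ennreal (m / t) * F t"
        unfolding F_def by (rule rearr_integral_average[OF t True])
      also have "\<dots> \<le> ennreal (5 ^ DIM('a) / t * m) * F t"
        using t m by (intro mult_right_mono ennreal_leI) (auto simp: divide_right_mono)
      also have "\<dots> = ?c * ennreal m"
        using cm by (simp only: mult_ac)
      finally show ?thesis .
    next
      case False
      then have "F m \<le> F t"
        unfolding F_def by (intro nn_integral_mono) (auto simp: indicator_def)
      also have "\<dots> = ennreal 1 * F t" by simp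
      also have "\<dots> \<le> ennreal (5 ^ DIM('a) / t * m) * F t"
        using t tm by (intro mult_right_mono ennreal_leI) (auto simp: field_simps)
      also have "\<dots> = ?c * ennreal m"
        using cm by (simp only: mult_ac)
      finally show ?thesis .
    qed
    with \<open>?c * ennreal m < F m\<close> show False by simp
  qed
qed

section \<open>Pointwise comparison of the potential with the Hardy operator\<close>

text \<open>\<open>P\<close> abstracts the extended nonlinearity: the pointwise comparisons ask only
  for its monotonicity, from which its measurability follows.\<close>

definition wolff_op :: "real \<Rightarrow> (ennreal \<Rightarrow> ennreal) \<Rightarrow> ('a::euclidean_space \<Rightarrow> ennreal) \<Rightarrow> 'a \<Rightarrow> ennreal" where
  "wolff_op \<alpha> P u x = (\<integral>\<^sup>+r\<in>{0<..}. ennreal (r powr (\<alpha> - 1)) *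
     P (ennreal (r powr (\<alpha> - real DIM('a))) * (\<integral>\<^sup>+y\<in>ball x r. u y \<partial>lebesgue)) \<partial>lborel)"

definition hardy_op :: "real \<Rightarrow> (ennreal \<Rightarrow> ennreal) \<Rightarrow> (real \<Rightarrow> ennreal) \<Rightarrow> real \<Rightarrow> ennreal" where
  "hardy_op \<beta> P v t = (\<integral>\<^sup>+s\<in>{t<..}. ennreal (s powr (\<beta> - 1)) *
     P (ennreal (s powr (\<beta> - 1)) * (\<integral>\<^sup>+y\<in>{0<..<s}. v y \<partial>lebesgue)) \<partial>lborel)"

lemma mono_initial_integral: "mono (\<lambda>s::real. \<integral>\<^sup>+y\<in>{0<..<s}. v y \<partial>lebesgue)"
  by (intro monoI nn_integral_mono) (auto simp: indicator_def)

lemma mono_ball_integral: "mono (\<lambda>r. \<integral>\<^sup>+y\<in>ball x r. u y \<partial>lebesgue)"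
  by (intro monoI nn_integral_mono) (auto simp: indicator_def)

lemma antimono_hardy_op: "antimono (hardy_op \<beta> P v)"
  unfolding hardy_op_def by (intro antimonoI nn_integral_mono) (auto simp: indicator_def)

lemma borel_measurable_hardy_op [measurable]: "hardy_op \<beta> P v \<in> borel_measurable borel"
  by (rule borel_measurable_antimono_real[OF antimono_hardy_op])

text \<open>Initial integrals are compared and not values, because this is how a function compares
  with its rearrangement.\<close>

lemma hardy_op_mono:
  assumes "mono P" "\<And>s. 0 < s \<Longrightarrow> (\<integral>\<^sup>+y\<in>{0<..<s}. v y \<partial>lebesgue) \<le> (\<integral>\<^sup>+y\<in>{0<..<s}. w y \<partial>lebesgue)"
    and "0 \<le> t"
  shows "hardy_op \<beta> P v t \<le> hardy_op \<beta> P w t"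
  unfolding hardy_op_def
proof (rule nn_integral_mono)
  fix s :: real
  show "ennreal (s powr (\<beta> - 1)) * P (ennreal (s powr (\<beta> - 1)) * (\<integral>\<^sup>+y\<in>{0<..<s}. v y \<partial>lebesgue)) * indicator {t<..} s
    \<le> ennreal (s powr (\<beta> - 1)) * P (ennreal (s powr (\<beta> - 1)) * (\<integral>\<^sup>+y\<in>{0<..<s}. w y \<partial>lebesgue)) * indicator {t<..} s"
    using assms(2)[of s] assms(3)
    by (cases "t < s") (auto intro!: mult_left_mono monoD[OF assms(1)])
qed

lemma set_nn_integral_cmult:
  assumes "f \<in> borel_measurable M" "S \<in> sets M"
  shows "(\<integral>\<^sup>+y\<in>S. c * f y \<partial>M) = c * (\<integral>\<^sup>+y\<in>S. f y \<partial>M)"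
  using assms by (simp add: mult.assoc nn_integral_cmult)

lemma hardy_op_scale:
  assumes "v \<in> borel_measurable lebesgue"
  shows "hardy_op \<beta> P (\<lambda>y. ennreal c * v y) t = (\<integral>\<^sup>+s\<in>{t<..}. ennreal (s powr (\<beta> - 1)) *
     P (ennreal c * ennreal (s powr (\<beta> - 1)) * (\<integral>\<^sup>+y\<in>{0<..<s}. v y \<partial>lebesgue)) \<partial>lborel)"
proof -
  have "(\<integral>\<^sup>+y\<in>{0<..<s}. ennreal c * v y \<partial>lebesgue) = ennreal c * (\<integral>\<^sup>+y\<in>{0<..<s}. v y \<partial>lebesgue)" for s
    by (rule set_nn_integral_cmult[OF assms]) simp
  then show ?thesis
    by (simp add: hardy_op_def mult_ac)
qed

text \<open>Only \<open>s\<close> in \<open>(t, 2 * t]\<close> are kept. There the weight is at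
  least its value at \<open>2 * t\<close>, the initial integral is at least its value at
  \<open>t\<close>, and the interval has length \<open>t\<close>.\<close>

lemma hardy_op_lower_bound:
  assumes P: "mono P" and "0 < t" "\<beta> \<le> 1"
  shows "ennreal (2 powr (\<beta> - 1) * t powr \<beta>) *
      P (ennreal ((2 * t) powr (\<beta> - 1)) * (\<integral>\<^sup>+y\<in>{0<..<t}. v y \<partial>lebesgue)) \<le> hardy_op \<beta> P v t"
proof -
  let ?k = "(2 * t) powr (\<beta> - 1)"
  let ?c = "ennreal ?k * P (ennreal ?k * (\<integral>\<^sup>+y\<in>{0<..<t}. v y \<partial>lebesgue))"
  have "2 powr (\<beta> - 1) * t powr \<beta> = ?k * t"
    using assms by (simp add: powr_mult powr_diff)
  then have "ennreal (2 powr (\<beta> - 1) * t powr \<beta>) *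
      P (ennreal ?k * (\<integral>\<^sup>+y\<in>{0<..<t}. v y \<partial>lebesgue)) = (\<integral>\<^sup>+s\<in>{t<..2 * t}. ?c \<partial>lborel)"
    using assms by (subst nn_integral_cmult_indicator) (auto simp: ennreal_mult mult_ac)
  also have "\<dots> \<le> hardy_op \<beta> P v t"
    unfolding hardy_op_def
  proof (rule nn_integral_mono)
    fix s :: real
    show "?c * indicator {t<..2 * t} s \<le> ennreal (s powr (\<beta> - 1)) *
       P (ennreal (s powr (\<beta> - 1)) * (\<integral>\<^sup>+y\<in>{0<..<s}. v y \<partial>lebesgue)) * indicator {t<..} s"
    proof (cases "t < s \<and> s \<le> 2 * t")
      case True
      then have "?k \<le> s powr (\<beta> - 1)"
        using assms by (intro powr_mono2') auto
      moreover have "(\<integral>\<^sup>+y\<in>{0<..<t}. v y \<partial>lebesgue) \<le> (\<integral>\<^sup>+y\<in>{0<..<s}. v y \<partial>lebesgue)"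
        using True by (intro monoD[OF mono_initial_integral]) simp
      ultimately have "?c \<le> ennreal (s powr (\<beta> - 1)) *
         P (ennreal (s powr (\<beta> - 1)) * (\<integral>\<^sup>+y\<in>{0<..<s}. v y \<partial>lebesgue))"
        by (intro mult_mono monoD[OF P] ennreal_leI) auto
      then show ?thesis using True by simp
    qed simp
  qed
  finally show ?thesis .
qed

context
  fixes \<alpha> :: real and P :: "ennreal \<Rightarrow> ennreal" and n :: real
  assumes alpha: "0 < \<alpha>" "\<alpha> < n" and P: "mono P"
begin

lemma radial_scaling:
  assumes "0 < s" "0 < d"
  shows "(d * s powr (1 / n)) powr (\<alpha> - n) = d powr (\<alpha> - n) * s powr (\<alpha> / n - 1)"
    and "d * (1 / n) * s powr (1 / n - 1) * (d * s powr (1 / n)) powr (\<alpha> - 1) =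
      d powr \<alpha> / n * s powr (\<alpha> / n - 1)"
proof -
  have n: "0 < n" using alpha by simp
  have e1: "1 / n * (\<alpha> - n) = \<alpha> / n - 1" using n by (simp add: field_simps)
  have e2: "(1 / n - 1) + 1 / n * (\<alpha> - 1) = \<alpha> / n - 1" using n by (simp add: field_simps)
  show "(d * s powr (1 / n)) powr (\<alpha> - n) = d powr (\<alpha> - n) * s powr (\<alpha> / n - 1)"
    using assms by (simp add: powr_mult powr_powr e1[symmetric])
  have "d * (1 / n) * s powr (1 / n - 1) * (d * s powr (1 / n)) powr (\<alpha> - 1) =
      (d powr 1 * d powr (\<alpha> - 1)) / n * (s powr (1 / n - 1) * s powr (1 / n * (\<alpha> - 1)))"
    using assms by (simp add: powr_mult powr_powr)
  also have "\<dots> = d powr \<alpha> / n * s powr (\<alpha> / n - 1)"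
    unfolding powr_add[symmetric] e2 by simp
  finally show "d * (1 / n) * s powr (1 / n - 1) * (d * s powr (1 / n)) powr (\<alpha> - 1) =
      d powr \<alpha> / n * s powr (\<alpha> / n - 1)" .
qed

text \<open>The variable \<open>s\<close> is proportional to the volume of the ball of radius
  \<open>r = d * s powr (1 / n)\<close>. Both \<open>r powr (\<alpha> - n)\<close> and
  \<open>r powr (\<alpha> - 1)\<close> times the Jacobian become multiples of
  \<open>s powr (\<alpha> / n - 1)\<close>, which is why the Hardy operator carries the same weight
  twice.\<close>

lemma radial_substitution:
  assumes I: "I \<in> borel_measurable borel" and t: "0 \<le> t" and d: "0 < d"
  shows "(\<integral>\<^sup>+r\<in>{d * t powr (1 / n)<..}. ennreal (r powr (\<alpha> - 1)) * P (ennreal (r powr (\<alpha> - n)) * I r) \<partial>lborel) =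
    ennreal (d powr \<alpha> / n) * (\<integral>\<^sup>+s\<in>{t<..}. ennreal (s powr (\<alpha> / n - 1)) *
      P (ennreal (d powr (\<alpha> - n)) * ennreal (s powr (\<alpha> / n - 1)) * I (d * s powr (1 / n))) \<partial>lborel)"
proof -
  have [measurable]: "P \<in> borel_measurable borel"
    by (rule borel_measurable_mono_complete[OF P])
  note [measurable] = I
  have "(\<integral>\<^sup>+r\<in>{d * t powr (1 / n)<..}. ennreal (r powr (\<alpha> - 1)) * P (ennreal (r powr (\<alpha> - n)) * I r) \<partial>lborel) =
    (\<integral>\<^sup>+s\<in>{t<..}. ennreal (d * (1 / n) * s powr (1 / n - 1)) * (ennreal ((d * s powr (1 / n)) powr (\<alpha> - 1)) *
      P (ennreal ((d * s powr (1 / n)) powr (\<alpha> - n)) * I (d * s powr (1 / n)))) \<partial>lborel)"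
    using d alpha t by (intro nn_integral_powr_substitution) auto
  also have "\<dots> = (\<integral>\<^sup>+s. ennreal (d powr \<alpha> / n) * (ennreal (s powr (\<alpha> / n - 1)) *
      P (ennreal (d powr (\<alpha> - n)) * ennreal (s powr (\<alpha> / n - 1)) * I (d * s powr (1 / n))) * indicator {t<..} s) \<partial>lborel)"
  proof (rule nn_integral_cong)
    fix s :: real
    show "ennreal (d * (1 / n) * s powr (1 / n - 1)) * (ennreal ((d * s powr (1 / n)) powr (\<alpha> - 1)) *
      P (ennreal ((d * s powr (1 / n)) powr (\<alpha> - n)) * I (d * s powr (1 / n)))) * indicator {t<..} s =
      ennreal (d powr \<alpha> / n) * (ennreal (s powr (\<alpha> / n - 1)) *
      P (ennreal (d powr (\<alpha> - n)) * ennreal (s powr (\<alpha> / n - 1)) * I (d * s powr (1 / n))) * indicator {t<..} s)"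
    proof (cases "t < s")
      case True
      then have s: "0 < s" using t by simp
      have "ennreal (d * (1 / n) * s powr (1 / n - 1)) * ennreal ((d * s powr (1 / n)) powr (\<alpha> - 1)) =
          ennreal (d powr \<alpha> / n) * ennreal (s powr (\<alpha> / n - 1))"
        using radial_scaling(2)[OF s d] alpha d by (simp flip: ennreal_mult)
      moreover have "ennreal ((d * s powr (1 / n)) powr (\<alpha> - n)) =
          ennreal (d powr (\<alpha> - n)) * ennreal (s powr (\<alpha> / n - 1))"
        using radial_scaling(1)[OF s d] by (simp flip: ennreal_mult)
      ultimately show ?thesis
        using True by (simp flip: mult.assoc)
    qed simp
  qed
  also have "\<dots> = ennreal (d powr \<alpha> / n) * (\<integral>\<^sup>+s\<in>{t<..}. ennreal (s powr (\<alpha> / n - 1)) *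
      P (ennreal (d powr (\<alpha> - n)) * ennreal (s powr (\<alpha> / n - 1)) * I (d * s powr (1 / n))) \<partial>lborel)"
    by (rule nn_integral_cmult) measurable
  finally show ?thesis .
qed

end

lemma lebesgue_measurable_rearr [measurable, simp]: "rearr u \<in> borel_measurable lebesgue"
  by (simp add: measurable_completion)

lemma rearr_initial_integral_lebesgue:
  "(\<integral>\<^sup>+y\<in>{0<..<s}. rearr u y \<partial>lebesgue) = (\<integral>\<^sup>+y\<in>{0<..<s}. rearr u y \<partial>lborel)"
  by (simp add: nn_integral_completion)

text \<open>\<open>\<kappa>\<close> is the radius of a ball of measure 1. In \<open>C\<close>, the
  power of 5 comes from the weak type bound, \<open>\<kappa> powr (\<alpha> - n)\<close> from the
  substitution, and \<open>2 powr (1 - \<alpha> / n)\<close> makes up for the weight at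
  \<open>2 * t\<close> in \<open>hardy_op_lower_bound\<close>. The summands of \<open>A\<close>
  belong to the far and to the near part.\<close>

lemma wolff_op_le_hardy_op:
  fixes u :: "'a::euclidean_space \<Rightarrow> ennreal" and \<alpha> :: real
  defines "n \<equiv> real DIM('a)"
  defines "\<omega> \<equiv> unit_ball_vol n"
  defines "\<kappa> \<equiv> \<omega> powr (-1 / n)"
  defines "C \<equiv> 5 ^ DIM('a) * \<kappa> powr (\<alpha> - n) * 2 powr (1 - \<alpha> / n)"
  defines "A \<equiv> \<kappa> powr \<alpha> / n + \<kappa> powr \<alpha> / \<alpha> * 2 powr (1 - \<alpha> / n)"
  assumes alpha: "0 < \<alpha>" "\<alpha> < n" and P: "mono P" and u: "u \<in> borel_measurable lebesgue" and t: "0 < t"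
    and x: "x \<notin> mean_exceeds u (ennreal (5 ^ DIM('a) / t) * (\<integral>\<^sup>+y\<in>{0<..<t}. rearr u y \<partial>lborel))"
  shows "wolff_op \<alpha> P u x \<le> ennreal A * hardy_op (\<alpha> / n) P (\<lambda>y. ennreal C * rearr u y) t"
proof -
  define F where "F s = (\<integral>\<^sup>+y\<in>{0<..<s}. rearr u y \<partial>lebesgue)" for s :: real
  define I where "I r = (\<integral>\<^sup>+y\<in>ball x r. u y \<partial>lebesgue)" for r
  define H where "H = hardy_op (\<alpha> / n) P (\<lambda>y. ennreal C * rearr u y) t"
  have n: "0 < n" using alpha by simp
  have omega: "0 < \<omega>" by (simp add: \<omega>_def n_def)
  have kappa: "0 < \<kappa>" using omega by (simp add: \<kappa>_def)
  have \<beta>: "\<alpha> / n \<le> 1" using alpha by simp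
  \<comment> \<open>\<open>C\<close> has to serve both parts: the far part produces only
    \<open>\<kappa> powr (\<alpha> - n)\<close>, and the other factors are at least 1.\<close>
  have C1: "\<kappa> powr (\<alpha> - n) \<le> C"
  proof -
    have "1 * 1 \<le> 5 ^ DIM('a) * (2 powr (1 - \<alpha> / n) :: real)"
      using \<beta> by (intro mult_mono ge_one_powr_ge_zero) auto
    then show ?thesis
      using mult_right_mono[of 1 "5 ^ DIM('a) * 2 powr (1 - \<alpha> / n)" "\<kappa> powr (\<alpha> - n)"]
      by (simp add: C_def mult_ac)
  qed
  have [measurable]: "P \<in> borel_measurable borel"
    by (rule borel_measurable_mono_complete[OF P])
  have I_meas [measurable]: "I \<in> borel_measurable borel"
    unfolding I_def by (rule borel_measurable_mono_real[OF mono_ball_integral])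
  have [measurable]: "F \<in> borel_measurable borel"
    unfolding F_def by (rule borel_measurable_mono_real[OF mono_initial_integral])
  have H_eq: "H = (\<integral>\<^sup>+s\<in>{t<..}. ennreal (s powr (\<alpha> / n - 1)) *
     P (ennreal C * ennreal (s powr (\<alpha> / n - 1)) * F s) \<partial>lborel)"
    unfolding H_def F_def by (rule hardy_op_scale) simp
  \<comment> \<open>The radius of a ball of measure \<open>t\<close>, where the two regimes
    meet.\<close>
  define \<rho> where "\<rho> = \<kappa> * t powr (1 / n)"
  have rho: "0 < \<rho>" using kappa t by (simp add: \<rho>_def)
  have vol: "\<omega> * (\<kappa> * s powr (1 / n)) ^ DIM('a) = s" if "0 < s" for s
  proof -
    have "(\<kappa> * s powr (1 / n)) ^ DIM('a) = (\<kappa> * s powr (1 / n)) powr n"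
      using kappa that by (simp add: n_def powr_realpow)
    also have "\<dots> = inverse \<omega> * s"
    proof -
      have "\<kappa> powr n = \<omega> powr (-1)"
        unfolding \<kappa>_def powr_powr using n by simp
      then show ?thesis
        using omega that n kappa by (simp add: powr_mult powr_powr powr_minus)
    qed
    finally show ?thesis using omega by simp
  qed
  let ?f = "\<lambda>r. ennreal (r powr (\<alpha> - 1)) * P (ennreal (r powr (\<alpha> - n)) * I r)"
  have far: "(\<integral>\<^sup>+r\<in>{\<rho><..}. ?f r \<partial>lborel) \<le> ennreal (\<kappa> powr \<alpha> / n) * H"
  proof -
    have "(\<integral>\<^sup>+r\<in>{\<rho><..}. ?f r \<partial>lborel) = ennreal (\<kappa> powr \<alpha> / n) * (\<integral>\<^sup>+s\<in>{t<..}. ennreal (s powr (\<alpha> / n - 1)) *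
      P (ennreal (\<kappa> powr (\<alpha> - n)) * ennreal (s powr (\<alpha> / n - 1)) * I (\<kappa> * s powr (1 / n))) \<partial>lborel)"
      unfolding \<rho>_def using alpha P t kappa by (intro radial_substitution I_meas) auto
    also have "\<dots> \<le> ennreal (\<kappa> powr \<alpha> / n) * H"
      unfolding H_eq
    proof (rule mult_left_mono[OF nn_integral_mono])
      fix s :: real
      show "ennreal (s powr (\<alpha> / n - 1)) *
          P (ennreal (\<kappa> powr (\<alpha> - n)) * ennreal (s powr (\<alpha> / n - 1)) * I (\<kappa> * s powr (1 / n))) * indicator {t<..} s
        \<le> ennreal (s powr (\<alpha> / n - 1)) * P (ennreal C * ennreal (s powr (\<alpha> / n - 1)) * F s) * indicator {t<..} s"
      proof (cases "t < s")
        case True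
        then have s: "0 < s" using t by simp
        have "emeasure lebesgue (ball x (\<kappa> * s powr (1 / n))) = ennreal s"
          using vol[OF s] kappa s unfolding \<omega>_def n_def by (subst emeasure_ball_eq) auto
        then have "I (\<kappa> * s powr (1 / n)) \<le> F s"
          unfolding I_def F_def rearr_initial_integral_lebesgue
          by (intro Hardy_Littlewood[OF u]) auto
        then show ?thesis
          using True C1 by (auto intro!: mult_left_mono mult_mono monoD[OF P] ennreal_leI)
      qed simp
    qed simp
    finally show ?thesis .
  qed
  have near: "(\<integral>\<^sup>+r\<in>{0<..\<rho>}. ?f r \<partial>lborel) \<le> ennreal (\<kappa> powr \<alpha> / \<alpha> * 2 powr (1 - \<alpha> / n)) * H"
  proof -
    \<comment> \<open>A bound for the argument of \<open>P\<close> uniform in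
      \<open>r \<le> \<rho>\<close>: once the ball average is bounded, the argument is at most a
      multiple of \<open>r powr \<alpha>\<close>, which is largest at \<open>\<rho>\<close>.\<close>
    let ?K = "ennreal (5 ^ DIM('a) * \<kappa> powr (\<alpha> - n) * t powr (\<alpha> / n - 1)) * F t"
    have "(\<integral>\<^sup>+r\<in>{0<..\<rho>}. ?f r \<partial>lborel) \<le> (\<integral>\<^sup>+r. P ?K * (ennreal (r powr (\<alpha> - 1)) * indicator {0<..\<rho>} r) \<partial>lborel)"
    proof (rule nn_integral_mono)
      fix r :: real
      show "?f r * indicator {0<..\<rho>} r \<le> P ?K * (ennreal (r powr (\<alpha> - 1)) * indicator {0<..\<rho>} r)"
      proof (cases "0 < r \<and> r \<le> \<rho>")
        case True
        then have r: "0 < r" "r \<le> \<rho>" by auto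
        \<comment> \<open>Since \<open>x\<close> lies in its own ball, this ball cannot be one of
          those that form \<open>mean_exceeds\<close>.\<close>
        have "\<not> ennreal (5 ^ DIM('a) / t) * F t * emeasure lebesgue (ball x r) < I r"
          using x r centre_in_ball[of x r] unfolding mean_exceeds_def F_def I_def rearr_initial_integral_lebesgue
          by blast
        then have "I r \<le> ennreal (5 ^ DIM('a) / t) * F t * ennreal (\<omega> * r ^ DIM('a))"
          using emeasure_ball_eq[of r x] r by (simp add: \<omega>_def n_def)
        then have "ennreal (r powr (\<alpha> - n)) * I r \<le>
            ennreal (r powr (\<alpha> - n)) * (ennreal (5 ^ DIM('a) / t) * F t * ennreal (\<omega> * r ^ DIM('a)))"
          by (rule mult_left_mono) simp
        also have "\<dots> = ennreal (r powr (\<alpha> - n) * (5 ^ DIM('a) / t) * (\<omega> * r ^ DIM('a))) * F t"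
        proof -
          have "ennreal (r powr (\<alpha> - n) * (5 ^ DIM('a) / t) * (\<omega> * r ^ DIM('a))) =
              ennreal (r powr (\<alpha> - n)) * ennreal (5 ^ DIM('a) / t) * ennreal (\<omega> * r ^ DIM('a))"
            using omega r t ennreal_mult[of "r powr (\<alpha> - n)" "5 ^ DIM('a) / t"]
              ennreal_mult[of "r powr (\<alpha> - n) * (5 ^ DIM('a) / t)" "\<omega> * r ^ DIM('a)"] by simp
          then show ?thesis by (simp only: mult_ac)
        qed
        also have "r powr (\<alpha> - n) * (5 ^ DIM('a) / t) * (\<omega> * r ^ DIM('a)) = 5 ^ DIM('a) * (\<omega> * r powr \<alpha> / t)"
          using r by (simp add: n_def powr_diff powr_realpow)
        also have "ennreal (5 ^ DIM('a) * (\<omega> * r powr \<alpha> / t)) * F t \<le> ?K"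
        proof (intro mult_right_mono ennreal_leI)
          have "\<omega> * r powr \<alpha> / t \<le> \<omega> * \<rho> powr \<alpha> / t"
            using r alpha omega t by (intro divide_right_mono mult_left_mono powr_mono2) auto
          also have "\<rho> powr \<alpha> = \<rho> powr (\<alpha> - n) * \<rho> ^ DIM('a)"
            using rho by (simp add: n_def powr_diff powr_realpow)
          also have "\<omega> * (\<rho> powr (\<alpha> - n) * \<rho> ^ DIM('a)) / t = \<rho> powr (\<alpha> - n)"
          proof -
            have "\<omega> * (\<rho> powr (\<alpha> - n) * \<rho> ^ DIM('a)) = \<rho> powr (\<alpha> - n) * (\<omega> * \<rho> ^ DIM('a))"
              by (rule mult.left_commute)
            also have "\<dots> = \<rho> powr (\<alpha> - n) * t"
              using vol[OF t] by (simp add: \<rho>_def)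
            finally have "\<omega> * (\<rho> powr (\<alpha> - n) * \<rho> ^ DIM('a)) = \<rho> powr (\<alpha> - n) * t" .
            then show ?thesis unfolding nonzero_divide_eq_eq[OF less_imp_neq[OF t, symmetric]] .
          qed
          also have "\<dots> = \<kappa> powr (\<alpha> - n) * t powr (\<alpha> / n - 1)"
            unfolding \<rho>_def using alpha P t kappa by (intro radial_scaling) auto
          finally show "5 ^ DIM('a) * (\<omega> * r powr \<alpha> / t) \<le> 5 ^ DIM('a) * \<kappa> powr (\<alpha> - n) * t powr (\<alpha> / n - 1)"
            unfolding mult.assoc[of "5 ^ DIM('a)" "\<kappa> powr (\<alpha> - n)"] by (rule mult_left_mono) simp
        qed simp
        finally have "ennreal (r powr (\<alpha> - n)) * I r \<le> ?K" .
        then have "?f r \<le> P ?K * ennreal (r powr (\<alpha> - 1))"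
          unfolding mult.commute[of "P ?K"] by (intro mult_left_mono monoD[OF P]) simp_all
        then show ?thesis
          using r by simp
      qed auto
    qed
    also have "\<dots> = P ?K * ennreal (\<rho> powr \<alpha> / \<alpha>)"
      using nn_integral_powr_Ioc[OF alpha(1) rho] by (simp add: nn_integral_cmult)
    also have "\<rho> powr \<alpha> / \<alpha> = \<kappa> powr \<alpha> / \<alpha> * t powr (\<alpha> / n)"
      using kappa t by (simp add: \<rho>_def powr_mult powr_powr)
    \<comment> \<open>The inserted powers of 2 cancel; they bring out the prefactor of
      \<open>hardy_op_lower_bound\<close>.\<close>
    also have "\<dots> = (\<kappa> powr \<alpha> / \<alpha> * 2 powr (1 - \<alpha> / n)) * (2 powr (\<alpha> / n - 1) * t powr (\<alpha> / n))"
      by (simp flip: powr_add)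
    also have "P ?K * ennreal \<dots> = ennreal (\<kappa> powr \<alpha> / \<alpha> * 2 powr (1 - \<alpha> / n)) *
        (ennreal (2 powr (\<alpha> / n - 1) * t powr (\<alpha> / n)) * P ?K)"
      using alpha by (subst ennreal_mult) (auto simp: mult_ac)
    \<comment> \<open>The power of 2 in \<open>C\<close> is chosen to make this an equality.\<close>
    also have "?K = ennreal ((2 * t) powr (\<alpha> / n - 1)) * (\<integral>\<^sup>+y\<in>{0<..<t}. ennreal C * rearr u y \<partial>lebesgue)"
    proof -
      have "(\<integral>\<^sup>+y\<in>{0<..<t}. ennreal C * rearr u y \<partial>lebesgue) = ennreal C * F t"
        unfolding F_def by (rule set_nn_integral_cmult) simp_all
      moreover have "5 ^ DIM('a) * \<kappa> powr (\<alpha> - n) * t powr (\<alpha> / n - 1) = (2 * t) powr (\<alpha> / n - 1) * C"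
        using t by (simp add: C_def powr_mult flip: powr_add)
      moreover have "0 \<le> C" by (simp add: C_def)
      ultimately show ?thesis
        by (simp add: ennreal_mult mult.assoc)
    qed
    also have "ennreal (2 powr (\<alpha> / n - 1) * t powr (\<alpha> / n)) * P \<dots> \<le> H"
      unfolding H_def by (rule hardy_op_lower_bound[OF P t \<beta>])
    finally show ?thesis by (simp add: mult_left_mono)
  qed
  have "wolff_op \<alpha> P u x = (\<integral>\<^sup>+r. ?f r * indicator {0<..\<rho>} r + ?f r * indicator {\<rho><..} r \<partial>lborel)"
    unfolding wolff_op_def I_def n_def using rho by (intro nn_integral_cong) (auto simp: indicator_def)
  also have "\<dots> = (\<integral>\<^sup>+r\<in>{0<..\<rho>}. ?f r \<partial>lborel) + (\<integral>\<^sup>+r\<in>{\<rho><..}. ?f r \<partial>lborel)"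
    by (rule nn_integral_add) measurable
  also have "\<dots> \<le> ennreal (\<kappa> powr \<alpha> / \<alpha> * 2 powr (1 - \<alpha> / n)) * H + ennreal (\<kappa> powr \<alpha> / n) * H"
    by (rule add_mono[OF near far])
  also have "\<dots> = ennreal A * H"
    using alpha n by (simp add: A_def ennreal_plus distrib_right add.commute)
  finally show ?thesis unfolding H_def .
qed

text \<open>With a Borel version of \<open>u\<close>, the integral over \<open>ball x r\<close> is a
  parametrized integral of a function that is jointly Borel in \<open>x\<close>, \<open>r\<close>
  and \<open>y\<close>.\<close>

lemma borel_measurable_wolff_op:
  fixes u :: "'a::euclidean_space \<Rightarrow> ennreal"
  assumes P: "mono P" and u: "u \<in> borel_measurable lebesgue"
  shows "wolff_op \<alpha> P u \<in> borel_measurable borel"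
proof -
  obtain v where v [measurable]: "v \<in> borel_measurable borel" and ae: "AE x in lborel. u x = v x"
    using completion_ex_borel_measurable[OF u] by auto
  have [measurable]: "P \<in> borel_measurable borel"
    by (rule borel_measurable_mono_complete[OF P])
  let ?J = "\<lambda>x r. \<integral>\<^sup>+y. v y * (if dist x y < r then 1 else 0) \<partial>lborel"
  have "wolff_op \<alpha> P u = (\<lambda>x. \<integral>\<^sup>+r\<in>{0<..}. ennreal (r powr (\<alpha> - 1)) *
     P (ennreal (r powr (\<alpha> - real DIM('a))) * ?J x r) \<partial>lborel)"
  proof
    fix x
    have "(\<integral>\<^sup>+y\<in>ball x r. u y \<partial>lebesgue) = ?J x r" for r
      unfolding nn_integral_completion using ae by (intro nn_integral_cong_AE) (auto simp: indicator_def)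
    then show "wolff_op \<alpha> P u x = (\<integral>\<^sup>+r\<in>{0<..}. ennreal (r powr (\<alpha> - 1)) *
      P (ennreal (r powr (\<alpha> - real DIM('a))) * ?J x r) \<partial>lborel)"
      by (simp add: wolff_op_def)
  qed
  also have "\<dots> \<in> borel_measurable borel"
    by measurable
  finally show ?thesis .
qed

section \<open>Radial functions\<close>

text \<open>For negative \<open>a\<close> both sides vanish, since \<open>ennreal\<close> truncates
  at 0; all half-lines can thus serve as generators in \<open>distr_radial\<close>.\<close>

lemma emeasure_radial_atMost:
  "emeasure lborel {x::'a::euclidean_space. unit_ball_vol (real DIM('a)) * norm x ^ DIM('a) \<le> a} = ennreal a"
proof (cases "0 \<le> a")
  case True
  define \<omega> where "\<omega> = unit_ball_vol (real DIM('a))"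
  have \<omega>: "0 < \<omega>" by (simp add: \<omega>_def)
  define R where "R = root DIM('a) (a / \<omega>)"
  have R: "0 \<le> R" "R ^ DIM('a) = a / \<omega>"
    using True \<omega> by (auto simp: R_def)
  have "{x::'a. \<omega> * norm x ^ DIM('a) \<le> a} = cball 0 R"
  proof -
    have "\<omega> * norm x ^ DIM('a) \<le> a \<longleftrightarrow> norm x \<le> R" for x :: 'a
    proof -
      have "\<omega> * norm x ^ DIM('a) \<le> a \<longleftrightarrow> norm x ^ DIM('a) \<le> R ^ DIM('a)"
        using \<omega> by (simp add: R(2) field_simps)
      also have "\<dots> \<longleftrightarrow> norm x \<le> R"
        using R(1) by (intro power_mono_iff) auto
      finally show ?thesis .
    qed
    then show ?thesis by (simp only: set_eq_iff mem_Collect_eq mem_cball_0 simp_thms)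
  qed
  then show ?thesis
    using emeasure_cball[OF R(1), of "0::'a"] R(2) \<omega> unfolding \<omega>_def[symmetric] by simp
next
  case False
  have "0 \<le> unit_ball_vol (real DIM('a)) * norm x ^ DIM('a)" for x :: 'a
    by simp
  then have "{x::'a. unit_ball_vol (real DIM('a)) * norm x ^ DIM('a) \<le> a} = {}"
    using False by (metis (no_types, lifting) Collect_empty_eq order_trans)
  then show ?thesis
    using False by (metis emeasure_empty ennreal_eq_0_iff linear)
qed

text \<open>The map sends \<open>x\<close> to the volume of the centred ball through
  \<open>x\<close>, so half-lines pull back to centred balls of matching measure. A function of this
  volume is therefore equimeasurable with its profile on \<open>(0, \<infinity>)\<close>.\<close>

lemma distr_radial:
  "distr lborel borel (\<lambda>x::'a::euclidean_space. unit_ball_vol (real DIM('a)) * norm x ^ DIM('a)) =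
    density lborel (indicator {0<..})"
  (is "?M = ?N")
proof (rule measure_eqI_generator_eq)
  have M: "emeasure ?M {..a} = ennreal a" for a
    using emeasure_radial_atMost[where 'a='a, of a]
    by (simp add: emeasure_distr vimage_def)
  have N: "emeasure ?N {..a} = ennreal a" for a
  proof -
    have "emeasure ?N {..a} = emeasure lborel ({0<..} \<inter> {..a})"
      by (simp add: emeasure_density flip: indicator_inter_arith)
    also have "{0<..} \<inter> {..a} = {0<..a}" by auto
    also have "emeasure lborel {0<..a} = ennreal a"
      by (cases "0 \<le> a") (auto simp: ennreal_neg)
    finally show ?thesis .
  qed
  show "emeasure ?M X = emeasure ?N X" if "X \<in> range atMost" for X
    using that M N by auto
  show "Int_stable (range (atMost :: real \<Rightarrow> _))"
    by (auto simp: Int_stable_def)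
  show "sets ?M = sigma_sets UNIV (range atMost)" "sets ?N = sigma_sets UNIV (range atMost)"
    by (simp_all add: borel_eq_atMost)
  show "range (\<lambda>i. {..real i}) \<subseteq> range atMost" by auto
  show "(\<Union>i. {..real i}) = UNIV"
  proof (rule UNIV_eq_I[symmetric])
    fix x :: real
    obtain i where "x \<le> real i"
      using real_arch_simple by blast
    then show "x \<in> (\<Union>i. {..real i})" by blast
  qed
  show "emeasure ?M {..real i} \<noteq> \<infinity>" for i
    by (simp add: M)
qed simp

lemma nn_integral_radial:
  fixes h :: "real \<Rightarrow> ennreal"
  assumes [measurable]: "h \<in> borel_measurable borel"
  shows "(\<integral>\<^sup>+(x::'a::euclidean_space). h (unit_ball_vol (real DIM('a)) * norm x ^ DIM('a)) \<partial>lborel) =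
    (\<integral>\<^sup>+t\<in>{0<..}. h t \<partial>lborel)"
proof -
  have "(\<integral>\<^sup>+(x::'a). h (unit_ball_vol (real DIM('a)) * norm x ^ DIM('a)) \<partial>lborel) =
    (\<integral>\<^sup>+t. h t \<partial>distr lborel borel (\<lambda>x::'a. unit_ball_vol (real DIM('a)) * norm x ^ DIM('a)))"
    by (subst nn_integral_distr) auto
  also have "\<dots> = (\<integral>\<^sup>+t\<in>{0<..}. h t \<partial>lborel)"
    unfolding distr_radial by (subst nn_integral_density) (auto simp: mult.commute)
  finally show ?thesis .
qed

lemma emeasure_radial:
  assumes [measurable]: "S \<in> sets borel"
  shows "emeasure lborel {x::'a::euclidean_space. unit_ball_vol (real DIM('a)) * norm x ^ DIM('a) \<in> S} =
    emeasure lborel (S \<inter> {0<..})"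
proof -
  have [measurable]: "{x::'a. unit_ball_vol (real DIM('a)) * norm x ^ DIM('a) \<in> S} \<in> sets borel"
    by measurable
  have "(\<integral>\<^sup>+(x::'a). indicator S (unit_ball_vol (real DIM('a)) * norm x ^ DIM('a)) \<partial>lborel) =
    (\<integral>\<^sup>+(x::'a). indicator {x. unit_ball_vol (real DIM('a)) * norm x ^ DIM('a) \<in> S} x \<partial>lborel)"
    by (intro nn_integral_cong) (auto simp: indicator_def)
  then show ?thesis
    using nn_integral_radial[where 'a='a, of "indicator S"] by (simp flip: indicator_inter_arith)
qed

text \<open>For \<open>s > t\<close> the centred ball of measure \<open>s\<close> has radius
  \<open>\<kappa> * s powr (1 / n)\<close>, and \<open>x\<close> is within twice that of the origin.
  The ball about \<open>x\<close> with three times the radius contains it, whence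
  \<open>d = 3 * \<kappa>\<close>. The 2 in the condition on \<open>x\<close> lets these points fill
  a ball of measure greater than \<open>t\<close>.\<close>

lemma radial_wolff_op_ge_hardy_op:
  fixes v :: "real \<Rightarrow> ennreal" and \<alpha> :: real and x :: "'a::euclidean_space"
  defines "n \<equiv> real DIM('a)"
  defines "\<omega> \<equiv> unit_ball_vol n"
  defines "\<kappa> \<equiv> \<omega> powr (-1 / n)"
  defines "d \<equiv> 3 * \<kappa>"
  assumes alpha: "0 < \<alpha>" "\<alpha> < n" and P: "mono P" and v: "v \<in> borel_measurable borel" and t: "0 < t"
    and x: "norm x < 2 * \<kappa> * t powr (1 / n)"
  shows "ennreal (d powr \<alpha> / n) * hardy_op (\<alpha> / n) P (\<lambda>y. ennreal (d powr (\<alpha> - n)) * v y) t \<le>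
    wolff_op \<alpha> P (\<lambda>x::'a. v (\<omega> * norm x ^ DIM('a))) x"
proof -
  define I where "I r = (\<integral>\<^sup>+y\<in>ball x r. v (\<omega> * norm y ^ DIM('a)) \<partial>lebesgue)" for r
  have n: "0 < n" using alpha by simp
  have omega: "0 < \<omega>" by (simp add: \<omega>_def n_def)
  have kappa: "0 < \<kappa>" using omega by (simp add: \<kappa>_def)
  note [measurable] = v
  have [measurable]: "P \<in> borel_measurable borel"
    by (rule borel_measurable_mono_complete[OF P])
  have I_meas [measurable]: "I \<in> borel_measurable borel"
    unfolding I_def by (rule borel_measurable_mono_real[OF mono_ball_integral])
  have v_leb: "v \<in> borel_measurable lebesgue"
    using v by (simp add: measurable_completion)
  have I_ge: "(\<integral>\<^sup>+y\<in>{0<..<s}. v y \<partial>lebesgue) \<le> I (d * s powr (1 / n))" if "t < s" for s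
  proof -
    have s: "0 < s" using that t by simp
    have ts: "t powr (1 / n) \<le> s powr (1 / n)"
      using that t n by (intro powr_mono2) auto
    have sub: "y \<in> ball x (d * s powr (1 / n))" if y: "\<omega> * norm y ^ DIM('a) < s" for y :: 'a
    proof -
      have "norm y < \<kappa> * s powr (1 / n)"
      proof (rule ccontr)
        assume "\<not> norm y < \<kappa> * s powr (1 / n)"
        then have "(\<kappa> * s powr (1 / n)) powr n \<le> norm y powr n"
          using n kappa s by (intro powr_mono2) auto
        moreover have "(\<kappa> * s powr (1 / n)) powr n = s / \<omega>"
        proof -
          have "\<kappa> powr n = \<omega> powr (-1)"
            unfolding \<kappa>_def powr_powr using n by simp
          then show ?thesis
            using omega s n kappa by (simp add: powr_mult powr_powr powr_minus field_simps)
        qed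
        moreover have "norm y powr n = norm y ^ DIM('a)"
          by (simp add: n_def powr_realpow')
        ultimately have "s / \<omega> \<le> norm y ^ DIM('a)" by simp
        with y omega show False by (simp add: field_simps)
      qed
      moreover have "dist x y \<le> norm x + norm y"
        by (simp add: dist_norm norm_triangle_ineq4)
      moreover have "\<kappa> * t powr (1 / n) \<le> \<kappa> * s powr (1 / n)"
        using ts kappa by simp
      ultimately show ?thesis
        using x by (simp add: d_def)
    qed
    have "(\<integral>\<^sup>+y\<in>{0<..<s}. v y \<partial>lebesgue) = (\<integral>\<^sup>+y\<in>{0<..}. v y * indicator {..<s} y \<partial>lborel)"
      unfolding nn_integral_completion by (intro nn_integral_cong) (auto simp: indicator_def)
    also have "\<dots> = (\<integral>\<^sup>+(y::'a). v (\<omega> * norm y ^ DIM('a)) * indicator {..<s} (\<omega> * norm y ^ DIM('a)) \<partial>lborel)"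
      unfolding \<omega>_def n_def by (rule nn_integral_radial[symmetric]) measurable
    also have "\<dots> \<le> I (d * s powr (1 / n))"
      unfolding I_def nn_integral_completion using sub
      by (intro nn_integral_mono) (auto simp: indicator_def)
    finally show ?thesis .
  qed
  let ?f = "\<lambda>r. ennreal (r powr (\<alpha> - 1)) * P (ennreal (r powr (\<alpha> - n)) * I r)"
  have "ennreal (d powr \<alpha> / n) * hardy_op (\<alpha> / n) P (\<lambda>y. ennreal (d powr (\<alpha> - n)) * v y) t \<le>
      ennreal (d powr \<alpha> / n) * (\<integral>\<^sup>+s\<in>{t<..}. ennreal (s powr (\<alpha> / n - 1)) *
      P (ennreal (d powr (\<alpha> - n)) * ennreal (s powr (\<alpha> / n - 1)) * I (d * s powr (1 / n))) \<partial>lborel)"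
    unfolding hardy_op_scale[OF v_leb]
  proof (rule mult_left_mono[OF nn_integral_mono])
    fix s :: real
    show "ennreal (s powr (\<alpha> / n - 1)) *
        P (ennreal (d powr (\<alpha> - n)) * ennreal (s powr (\<alpha> / n - 1)) * (\<integral>\<^sup>+y\<in>{0<..<s}. v y \<partial>lebesgue)) * indicator {t<..} s
      \<le> ennreal (s powr (\<alpha> / n - 1)) *
        P (ennreal (d powr (\<alpha> - n)) * ennreal (s powr (\<alpha> / n - 1)) * I (d * s powr (1 / n))) * indicator {t<..} s"
      using I_ge[of s] by (cases "t < s") (auto intro!: mult_left_mono monoD[OF P])
  qed simp
  also have "\<dots> = (\<integral>\<^sup>+r\<in>{d * t powr (1 / n)<..}. ?f r \<partial>lborel)"
    using alpha P t kappa by (intro radial_substitution[symmetric] I_meas) (auto simp: d_def)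
  also have "\<dots> \<le> (\<integral>\<^sup>+r\<in>{0<..}. ?f r \<partial>lborel)"
    using kappa by (intro nn_integral_mono) (auto simp: indicator_def d_def intro: le_less_trans[rotated])
  also have "\<dots> = wolff_op \<alpha> P (\<lambda>x::'a. v (\<omega> * norm x ^ DIM('a))) x"
    unfolding wolff_op_def I_def n_def ..
  finally show ?thesis .
qed

text \<open>Monotone convergence is applied to the inner and to the outer integral; in between the
  supremum has to pass through \<open>P\<close>.\<close>

lemma hardy_op_SUP:
  assumes P: "mono P" "\<And>w :: nat \<Rightarrow> ennreal. P (SUP k. w k) = (SUP k. P (w k))"
    and v: "\<And>k :: nat. v k \<in> borel_measurable lebesgue" "incseq v"
  shows "hardy_op \<beta> P (\<lambda>y. SUP k. v k y) t = (SUP k. hardy_op \<beta> P (v k) t)"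
proof -
  define F where "F k s = (\<integral>\<^sup>+y\<in>{0<..<s}. v k y \<partial>lebesgue)" for k and s :: real
  have [measurable]: "P \<in> borel_measurable borel"
    by (rule borel_measurable_mono_complete[OF P(1)])
  have [measurable]: "F k \<in> borel_measurable borel" for k
    unfolding F_def by (rule borel_measurable_mono_real[OF mono_initial_integral])
  have inc: "F k s \<le> F (Suc k) s" for k s
    unfolding F_def using incseq_SucD[OF v(2)]
    by (intro nn_integral_mono mult_right_mono) (auto simp: le_fun_def)
  have "(\<integral>\<^sup>+y\<in>{0<..<s}. (SUP k. v k y) \<partial>lebesgue) = (SUP k. F k s)"
    (is "?L s = _") for s
  proof -
    have "(\<integral>\<^sup>+y\<in>{0<..<s}. (SUP k. v k y) \<partial>lebesgue) = (\<integral>\<^sup>+y. (SUP k. v k y * indicator {0<..<s} y) \<partial>lebesgue)"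
      by (intro nn_integral_cong) (auto simp: indicator_def)
    also have "\<dots> = (SUP k. F k s)"
      unfolding F_def
    proof (rule nn_integral_monotone_convergence_SUP)
      show "incseq (\<lambda>k y. v k y * indicator {0<..<s} y)"
        using incseq_SucD[OF v(2)] by (intro incseq_SucI le_funI mult_right_mono) (auto simp: le_fun_def)
      show "(\<lambda>y. v k y * indicator {0<..<s} y) \<in> borel_measurable lebesgue" for k
        by (rule borel_measurable_times_ennreal[OF v(1) borel_measurable_indicator]) simp
    qed
    finally show ?thesis .
  qed
  then have L: "?L = (\<lambda>s. SUP k. F k s)" by (rule ext)
  have pull: "a * P (b * (SUP k. F k s)) * c = (SUP k. a * P (b * F k s) * c)" for a b c s
  proof -
    have "b * (SUP k. F k s) = (SUP k. b * F k s)"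
      by (rule SUP_mult_left_ennreal)
    then have "P (b * (SUP k. F k s)) = (SUP k. P (b * F k s))"
      using P(2)[of "\<lambda>k. b * F k s"] by simp
    then have "a * P (b * (SUP k. F k s)) = (SUP k. a * P (b * F k s))"
      using SUP_mult_left_ennreal[of a "\<lambda>k. P (b * F k s)" UNIV] by simp
    then show ?thesis
      using SUP_mult_right_ennreal[of "\<lambda>k. a * P (b * F k s)" UNIV c] by simp
  qed
  have "hardy_op \<beta> P (\<lambda>y. SUP k. v k y) t =
      (\<integral>\<^sup>+s. (SUP k. ennreal (s powr (\<beta> - 1)) * P (ennreal (s powr (\<beta> - 1)) * F k s) * indicator {t<..} s) \<partial>lborel)"
    unfolding hardy_op_def fun_cong[OF L] pull by (rule refl)
  also have "\<dots> = (SUP k. hardy_op \<beta> P (v k) t)"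
    unfolding hardy_op_def F_def[symmetric]
  proof (rule nn_integral_monotone_convergence_SUP)
    show "incseq (\<lambda>k s. ennreal (s powr (\<beta> - 1)) * P (ennreal (s powr (\<beta> - 1)) * F k s) * indicator {t<..} s)"
    proof (intro incseq_SucI le_funI)
      fix k s
      have "P (ennreal (s powr (\<beta> - 1)) * F k s) \<le> P (ennreal (s powr (\<beta> - 1)) * F (Suc k) s)"
        by (rule monoD[OF P(1) mult_left_mono[OF inc]]) simp
      then show "ennreal (s powr (\<beta> - 1)) * P (ennreal (s powr (\<beta> - 1)) * F k s) * indicator {t<..} s \<le>
          ennreal (s powr (\<beta> - 1)) * P (ennreal (s powr (\<beta> - 1)) * F (Suc k) s) * indicator {t<..} s"
        by (rule mult_right_mono[OF mult_left_mono]) simp_all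
    qed
    fix k
    have "(\<lambda>s. P (ennreal (s powr (\<beta> - 1)) * F k s)) \<in> borel_measurable lborel"
      by measurable
    then show "(\<lambda>s. ennreal (s powr (\<beta> - 1)) * P (ennreal (s powr (\<beta> - 1)) * F k s) * indicator {t<..} s) \<in> borel_measurable lborel"
      by (intro borel_measurable_times_ennreal) simp_all
  qed
  finally show ?thesis .
qed

section \<open>Function spaces and truncation\<close>

lemma function_spaceD:
  assumes "quasi_normed_function_space \<Omega> N"
  shows function_space_measurable: "N f < \<infinity> \<Longrightarrow> f \<in> borel_measurable (lebesgue_on \<Omega>)"
    and function_space_scale: "N f < \<infinity> \<Longrightarrow> N (\<lambda>x. ereal a * f x) = ennreal \<bar>a\<bar> * N f"
    and function_space_mono: "f \<in> borel_measurable (lebesgue_on \<Omega>) \<Longrightarrow> g \<in> borel_measurable (lebesgue_on \<Omega>) \<Longrightarrow>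
      (\<And>x. x \<in> \<Omega> \<Longrightarrow> \<bar>g x\<bar> \<le> \<bar>f x\<bar>) \<Longrightarrow> N g \<le> N f"
    and function_space_indicator: "E \<in> sets lebesgue \<Longrightarrow> E \<subseteq> \<Omega> \<Longrightarrow> emeasure lebesgue E < \<infinity> \<Longrightarrow>
      N (indicator E) < \<infinity>"
proof -
  note Q = assms[unfolded quasi_normed_function_space_def]
  note Q2 = Q[THEN conjunct2, THEN conjunct2]
  note Q5 = Q2[THEN conjunct2, THEN conjunct2]
  show "N f < \<infinity> \<Longrightarrow> f \<in> borel_measurable (lebesgue_on \<Omega>)"
    by (rule Q[THEN conjunct1, rule_format])
  show "N f < \<infinity> \<Longrightarrow> N (\<lambda>x. ereal a * f x) = ennreal \<bar>a\<bar> * N f"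
    by (rule Q2[THEN conjunct1, rule_format])
  show "N (indicator E) < \<infinity>" if "E \<in> sets lebesgue" "E \<subseteq> \<Omega>" "emeasure lebesgue E < \<infinity>"
    using that by (intro Q5[THEN conjunct2, THEN conjunct2, THEN conjunct1, rule_format]) simp
  assume f: "f \<in> borel_measurable (lebesgue_on \<Omega>)" "g \<in> borel_measurable (lebesgue_on \<Omega>)"
    and le: "\<And>x. x \<in> \<Omega> \<Longrightarrow> \<bar>g x\<bar> \<le> \<bar>f x\<bar>"
  have "AE x in lebesgue_on \<Omega>. \<bar>g x\<bar> \<le> \<bar>f x\<bar>"
    by (rule AE_I2) (simp add: le)
  then show "N g \<le> N f"
    by (rule Q5[THEN conjunct1, rule_format, OF f])
qed

text \<open>Carries a bound to a limit that is not known to belong to the space, so that identities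
  stated for members can be used along the approximating sequence.\<close>

lemma function_space_Fatou:
  assumes Q: "quasi_normed_function_space \<Omega> N"
    and meas: "\<And>k::nat. w k \<in> borel_measurable (lebesgue_on \<Omega>)"
    and lim: "\<And>x. x \<in> \<Omega> \<Longrightarrow> incseq (\<lambda>k. w k x)" "\<And>x. x \<in> \<Omega> \<Longrightarrow> (SUP k. w k x) = w' x"
    and bound: "\<And>k. N (\<lambda>x. enn2ereal (w k x)) \<le> B"
  shows "N (\<lambda>x. enn2ereal (w' x)) \<le> B"
proof -
  have tends: "(\<lambda>k. w k x) \<longlonglongrightarrow> w' x" if "x \<in> \<Omega>" for x
    using LIMSEQ_SUP[OF lim(1)[OF that]] lim(2)[OF that] by simp
  have meas': "w' \<in> borel_measurable (lebesgue_on \<Omega>)"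
  proof -
    have "(\<lambda>x. SUP k. w k x) \<in> borel_measurable (lebesgue_on \<Omega>)"
      using meas by (intro borel_measurable_SUP) auto
    also have "?this \<longleftrightarrow> w' \<in> borel_measurable (lebesgue_on \<Omega>)"
      using lim(2) by (intro measurable_cong) simp
    finally show ?thesis .
  qed
  have "AE x in lebesgue_on \<Omega>. (\<forall>k. 0 \<le> enn2ereal (w k x)) \<and> incseq (\<lambda>k. enn2ereal (w k x)) \<and>
      (\<lambda>k. enn2ereal (w k x)) \<longlonglongrightarrow> enn2ereal (w' x)"
  proof (rule AE_I2, intro conjI allI)
    fix x assume "x \<in> space (lebesgue_on \<Omega>)"
    then have x: "x \<in> \<Omega>" by simp
    show "incseq (\<lambda>k. enn2ereal (w k x))"
      using lim(1)[OF x] by (auto simp: incseq_def less_eq_ennreal.rep_eq)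
    show "(\<lambda>k. enn2ereal (w k x)) \<longlonglongrightarrow> enn2ereal (w' x)"
      using tends[OF x] by (rule tendsto_enn2erealI)
  qed simp
  moreover have "(\<lambda>x. enn2ereal (w k x)) \<in> borel_measurable (lebesgue_on \<Omega>)" for k
    using meas by (rule measurable_compose) simp
  moreover have "(\<lambda>x. enn2ereal (w' x)) \<in> borel_measurable (lebesgue_on \<Omega>)"
    using meas' by (rule measurable_compose) simp
  ultimately have "(\<lambda>k. N (\<lambda>x. enn2ereal (w k x))) \<longlonglongrightarrow> N (\<lambda>x. enn2ereal (w' x))"
    by (intro Q[unfolded quasi_normed_function_space_def, THEN conjunct2, THEN conjunct2, THEN conjunct2,
          THEN conjunct2, THEN conjunct2, THEN conjunct1, rule_format, THEN conjunct2] conjI allI)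
  then show ?thesis
    using bound by (intro LIMSEQ_le_const2) auto
qed

lemma borel_measurable_enn2ereal_restrict:
  assumes "w \<in> borel_measurable lebesgue"
  shows "(\<lambda>x. enn2ereal (w x)) \<in> borel_measurable (lebesgue_on \<Omega>)"
  using measurable_restrict_space1[OF assms, of \<Omega>] by (rule measurable_compose) simp

text \<open>Membership comes from the indicator axiom, homogeneity and the lattice property.\<close>

lemma function_space_bounded:
  assumes Q: "quasi_normed_function_space \<Omega> N"
    and w: "w \<in> borel_measurable lebesgue"
    and E: "E \<in> sets lebesgue" "E \<subseteq> \<Omega>" "emeasure lebesgue E < \<infinity>"
    and bound: "\<And>x. x \<in> \<Omega> \<Longrightarrow> w x \<le> ennreal b * indicator E x" "0 \<le> b"
  shows "N (\<lambda>x. enn2ereal (w x)) < \<infinity>"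
proof -
  have fin: "N (indicator E) < \<infinity>"
    by (rule function_space_indicator[OF Q E])
  have eq: "(\<lambda>x. ereal b * indicator E x) = (\<lambda>x. enn2ereal (ennreal b * indicator E x))"
  proof
    show "ereal b * indicator E x = enn2ereal (ennreal b * indicator E x)" for x
      using bound(2) by (cases "x \<in> E") (auto simp: zero_ennreal.rep_eq simp flip: zero_ereal_def)
  qed
  have "N (\<lambda>x. enn2ereal (w x)) \<le> N (\<lambda>x. ereal b * indicator E x)"
  proof (rule function_space_mono[OF Q])
    show "(\<lambda>x. ereal b * indicator E x) \<in> borel_measurable (lebesgue_on \<Omega>)"
      unfolding eq by (rule borel_measurable_enn2ereal_restrict) (use E in simp)
    show "(\<lambda>x. enn2ereal (w x)) \<in> borel_measurable (lebesgue_on \<Omega>)"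
      by (rule borel_measurable_enn2ereal_restrict[OF w])
    show "\<bar>enn2ereal (w x)\<bar> \<le> \<bar>ereal b * indicator E x\<bar>" if "x \<in> \<Omega>" for x
      using bound(1)[OF that] by (simp add: fun_cong[OF eq] less_eq_ennreal.rep_eq)
  qed
  also have "\<dots> = ennreal \<bar>b\<bar> * N (indicator E)"
    by (rule function_space_scale[OF Q fin])
  also have "\<dots> < \<infinity>"
    using fin by (simp add: ennreal_mult_less_top)
  finally show ?thesis .
qed

text \<open>Height and support are cut with the same index, so that one increasing sequence makes a
  measurable function bounded with support of finite measure.\<close>

definition truncate :: "nat \<Rightarrow> ('a::real_normed_vector \<Rightarrow> ennreal) \<Rightarrow> 'a \<Rightarrow> ennreal" where
  "truncate k w x = min (w x) (of_nat k) * indicator (ball 0 (real k)) x"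

lemma truncate_le: "truncate k w x \<le> w x"
  by (auto simp: truncate_def indicator_def)

lemma incseq_truncate: "incseq (\<lambda>k. truncate k w x)"
proof (rule incseq_SucI)
  fix k
  have "(of_nat k :: ennreal) \<le> of_nat (Suc k)" by (simp only: of_nat_mono le_SucI order_refl)
  then have "min (w x) (of_nat k) \<le> min (w x) (of_nat (Suc k))"
    by (intro min.mono order_refl)
  then show "truncate k w x \<le> truncate (Suc k) w x"
    unfolding truncate_def by (intro mult_mono) (auto simp: indicator_def)
qed

lemma SUP_truncate: "(SUP k. truncate k w x) = w x"
proof (rule antisym)
  show "(SUP k. truncate k w x) \<le> w x"
    by (intro SUP_least truncate_le)
  show "w x \<le> (SUP k. truncate k w x)"
  proof (rule ennreal_le_of_real_less)
    fix s :: real assume s: "0 \<le> s" "ennreal s < w x"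
    obtain k where k: "max s (norm x) < real k"
      using reals_Archimedean2 by blast
    then have "ennreal s \<le> of_nat k"
      unfolding ennreal_of_nat_eq_real_of_nat by (intro ennreal_leI) simp
    then have "ennreal s \<le> truncate k w x"
      using k s by (simp add: truncate_def less_imp_le)
    then show "ennreal s \<le> (SUP k. truncate k w x)"
      by (rule order_trans) (intro SUP_upper UNIV_I)
  qed
qed

lemma borel_measurable_truncate:
  fixes w :: "'a::euclidean_space \<Rightarrow> ennreal"
  assumes "w \<in> borel_measurable lebesgue"
  shows "truncate k w \<in> borel_measurable lebesgue"
proof -
  have "(\<lambda>x. min (w x) (of_nat k) * indicator (ball 0 (real k)) x) \<in> borel_measurable lebesgue"
    by (intro borel_measurable_times_ennreal borel_measurable_min assms borel_measurable_const
        borel_measurable_indicator) simp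
  then show ?thesis by (simp add: truncate_def[abs_def])
qed

lemma truncate_le_indicator: "truncate k w x \<le> ennreal (real k) * indicator (ball 0 (real k)) x"
  by (auto simp: truncate_def indicator_def ennreal_of_nat_eq_real_of_nat)

section \<open>Translation of the given notions into \<open>tail_measure\<close>,
  \<open>rearr\<close>, \<open>wolff_op\<close> and \<open>hardy_op\<close>\<close>

lemma distribution_on_eq_tail_measure:
  assumes "0 \<le> s" "\<And>x. x \<notin> \<Omega> \<Longrightarrow> u x = 0" "\<And>x. x \<in> \<Omega> \<Longrightarrow> e2ennreal \<bar>f x\<bar> = u x"
  shows "distribution_on \<Omega> f s = tail_measure u s"
proof -
  have "ereal s < \<bar>f x\<bar> \<longleftrightarrow> ennreal s < u x" if "x \<in> \<Omega>" for x
  proof -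
    have "ennreal s < e2ennreal \<bar>f x\<bar> \<longleftrightarrow> ereal s < \<bar>f x\<bar>"
      using assms(1) by (simp add: less_ennreal.rep_eq enn2ereal_e2ennreal)
    then show ?thesis using assms(3)[OF that] by simp
  qed
  then have "{x\<in>\<Omega>. ereal s < \<bar>f x\<bar>} = {x. ennreal s < u x}"
    using assms(2) by force
  then show ?thesis
    by (simp add: distribution_on_def tail_measure_def)
qed

lemma decreasing_rearrangement_eq_rearr:
  assumes "\<And>x. x \<notin> \<Omega> \<Longrightarrow> u x = 0" "\<And>x. x \<in> \<Omega> \<Longrightarrow> e2ennreal \<bar>f x\<bar> = u x"
  shows "decreasing_rearrangement \<Omega> f = (\<lambda>t. enn2ereal (rearr u t))"
proof -
  have "{ennreal s |s::real. 0 \<le> s \<and> ennreal t < distribution_on \<Omega> f s} =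
      {ennreal s |s. 0 \<le> s \<and> ennreal t < tail_measure u s}" for t
    using distribution_on_eq_tail_measure[where \<Omega>=\<Omega> and u=u and f=f, OF _ assms] by metis
  then show ?thesis
    by (simp add: decreasing_rearrangement_def rearr_def fun_eq_iff)
qed

lemma rearr_eq_0:
  assumes "\<And>s. 0 \<le> s \<Longrightarrow> tail_measure u s \<le> ennreal t"
  shows "rearr u t = 0"
proof -
  have "{ennreal s |s. 0 \<le> s \<and> ennreal t < tail_measure u s} = {}"
    using assms by (auto dest: leD)
  then show ?thesis unfolding rearr_def by (simp only: Sup_empty bot_ennreal)
qed

lemma borel_measurable_extend_by_zero:
  assumes "f \<in> borel_measurable (lebesgue_on \<Omega>)" "\<Omega> \<in> sets lebesgue"
  shows "(\<lambda>x. e2ennreal \<bar>extend_by_zero \<Omega> f x\<bar>) \<in> borel_measurable lebesgue"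
proof -
  have "(\<lambda>x. if x \<in> \<Omega> then f x else 0) \<in> borel_measurable lebesgue"
    using assms by (subst measurable_restrict_space_iff[symmetric]) auto
  then have "(\<lambda>x. \<bar>extend_by_zero \<Omega> f x\<bar>) \<in> borel_measurable lebesgue"
    unfolding extend_by_zero_def by (rule borel_measurable_ereal_abs)
  then show ?thesis
    by (rule measurable_compose) simp
qed

lemma wolff_potential_eq_wolff_op:
  "wolff_potential \<alpha> \<psi> f x = wolff_op \<alpha> (extend_at_infinity \<psi>) (\<lambda>y. e2ennreal \<bar>f y\<bar>) x"
  by (simp add: wolff_potential_def wolff_op_def)

lemma hardy_operator_eq_hardy_op:
  assumes "0 \<le> t" "\<And>y. 0 < y \<Longrightarrow> e2ennreal (\<phi> y) = v y"
  shows "hardy_operator \<beta> \<psi> \<phi> t = hardy_op \<beta> (extend_at_infinity \<psi>) v t"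
proof -
  have "(\<integral>\<^sup>+y\<in>{0<..<s}. e2ennreal (\<phi> y) \<partial>lebesgue) = (\<integral>\<^sup>+y\<in>{0<..<s}. v y \<partial>lebesgue)" for s
    using assms(2) by (intro nn_integral_cong) (auto simp: indicator_def)
  then show ?thesis
    by (simp add: hardy_operator_def hardy_op_def)
qed

lemma representation_spaceD:
  assumes "representation_space \<Omega> N N'"
  shows representation_space_quasi_normed: "quasi_normed_function_space (measure_interval \<Omega>) N'"
    and representation_space_norm: "N f < \<infinity> \<Longrightarrow> N' (decreasing_rearrangement \<Omega> f) = N f"
  using assms unfolding representation_space_def rearrangement_invariant_space_def by auto

section \<open>The reduction principle\<close>

text \<open>The final constant is \<open>A * c * C\<close>: \<open>A\<close> from the pointwise
  bound, \<open>c\<close> from the Hardy inequality, and \<open>C\<close> from testing the latter on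
  \<open>C\<close> times the rearrangement of \<open>f\<close>.\<close>

lemma potential_boundedI:
  fixes \<psi> :: "real \<Rightarrow> real" and \<Omega> :: "'a::euclidean_space set"
  assumes mono: "mono_on {0..} \<psi>"
    and alpha: "0 < \<alpha>" "\<alpha> < real DIM('a)"
    and Omega: "\<Omega> \<in> sets lebesgue"
    and X: "quasi_normed_function_space \<Omega> NX"
    and Y: "quasi_normed_function_space \<Omega> NY"
    and X': "representation_space \<Omega> NX NX'"
    and Y': "representation_space \<Omega> NY NY'"
    and hardy: "hardy_bounded \<alpha> \<psi> \<Omega> NX' NY'"
  shows "potential_bounded \<alpha> \<psi> \<Omega> NX NY"
proof -
  define n where "n = real DIM('a)"
  define \<kappa> where "\<kappa> = unit_ball_vol n powr (-1 / n)"
  define C where "C = 5 ^ DIM('a) * \<kappa> powr (\<alpha> - n) * 2 powr (1 - \<alpha> / n)"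
  define A where "A = \<kappa> powr \<alpha> / n + \<kappa> powr \<alpha> / \<alpha> * 2 powr (1 - \<alpha> / n)"
  define J where "J = measure_interval \<Omega>"
  define P where "P = extend_at_infinity \<psi>"
  have kappa: "0 < \<kappa>" using less_imp_neq[OF unit_ball_vol_pos[of n]] by (simp add: \<kappa>_def n_def)
  have n: "0 < n" "\<alpha> < n" using alpha by (simp_all add: n_def)
  have C: "0 < C" using kappa by (simp add: C_def)
  have A: "0 < A" using kappa n alpha by (auto simp: A_def intro!: add_pos_pos)
  have P: "mono P" unfolding P_def by (rule mono_extend_at_infinity[OF mono])
  note QX' = representation_space_quasi_normed[OF X', folded J_def]
  note QY' = representation_space_quasi_normed[OF Y', folded J_def]
  obtain c where c: "0 < c" and bound: "\<And>\<phi>. NX' \<phi> < \<infinity> \<Longrightarrow> (\<And>t. t \<in> J \<Longrightarrow> 0 \<le> \<phi> t) \<Longrightarrow>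
      NY' (\<lambda>t. enn2ereal (hardy_operator (\<alpha> / n) \<psi> (extend_by_zero J \<phi>) t)) \<le> ennreal c * NX' \<phi>"
    using hardy unfolding hardy_bounded_def J_def n_def by blast
  have "NY (\<lambda>x. enn2ereal (wolff_potential \<alpha> \<psi> (extend_by_zero \<Omega> f) x)) \<le> ennreal (A * c * C) * NX f"
    if f: "NX f < \<infinity>" for f
  proof -
    define u where "u x = e2ennreal \<bar>extend_by_zero \<Omega> f x\<bar>" for x
    define W where "W = wolff_op \<alpha> P u"
    define H where "H = hardy_op (\<alpha> / n) P (\<lambda>y. ennreal C * rearr u y)"
    have u: "u \<in> borel_measurable lebesgue"
      unfolding u_def[abs_def]
      by (rule borel_measurable_extend_by_zero[OF function_space_measurable[OF X f] Omega])
    have W_borel: "W \<in> borel_measurable borel"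
      unfolding W_def by (rule borel_measurable_wolff_op[OF P u])
    then have W: "W \<in> borel_measurable lebesgue"
      by (simp add: measurable_completion)
    have H_leb: "(\<lambda>t. ennreal A * H t) \<in> borel_measurable lebesgue" "H \<in> borel_measurable lebesgue"
      unfolding H_def by (simp_all add: measurable_completion)
    have W_le: "rearr W t \<le> ennreal A * H t" if t: "0 < t" for t
    proof (rule rearr_le[OF W])
      let ?E = "mean_exceeds u (ennreal (5 ^ DIM('a) / t) * (\<integral>\<^sup>+y\<in>{0<..<t}. rearr u y \<partial>lborel))"
      have "open ?E"
        unfolding mean_exceeds_def by (intro open_Union) auto
      then show "?E \<in> sets lebesgue" by (simp add: borel_open)
      show "emeasure lebesgue ?E \<le> ennreal t"
        using mean_exceeds_weak_type[OF u t] \<open>open ?E\<close> by (simp add: borel_open)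
      show "W x \<le> ennreal A * H t" if "x \<notin> ?E" for x
        unfolding W_def H_def A_def C_def \<kappa>_def n_def
        by (rule wolff_op_le_hardy_op) (use alpha P u t that in auto)
    qed
    have rearr_f: "decreasing_rearrangement \<Omega> f = (\<lambda>t. enn2ereal (rearr u t))"
      by (rule decreasing_rearrangement_eq_rearr) (simp_all add: u_def extend_by_zero_def zero_ennreal_def)
    have NX_f: "NX' (\<lambda>t. enn2ereal (rearr u t)) = NX f"
      using representation_space_norm[OF X' f] by (simp add: rearr_f)
    define \<phi> where "\<phi> t = ereal C * enn2ereal (rearr u t)" for t
    have \<phi>_eq: "\<phi> t = enn2ereal (ennreal C * rearr u t)" for t
      using C by (simp add: \<phi>_def times_ennreal.rep_eq)
    have NX_\<phi>: "NX' \<phi> = ennreal C * NX f"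
      using function_space_scale[OF QX', of "\<lambda>t. enn2ereal (rearr u t)" C] C f
      by (simp add: \<phi>_def[abs_def] NX_f)
    have H_eq: "hardy_operator (\<alpha> / n) \<psi> (extend_by_zero J \<phi>) t = H t" if "0 < t" for t
      unfolding H_def P_def
    proof (rule hardy_operator_eq_hardy_op)
      fix y :: real assume y: "0 < y"
      show "e2ennreal (extend_by_zero J \<phi> y) = ennreal C * rearr u y"
      proof (cases "y \<in> J")
        case True
        then show ?thesis by (simp add: extend_by_zero_def \<phi>_eq)
      next
        \<comment> \<open>A positive point outside \<open>J\<close> is at least the measure of
          \<open>\<Omega>\<close>, where the rearrangement vanishes; extension by zero thus changes
          nothing.\<close>
        case False
        then have le: "emeasure lebesgue \<Omega> \<le> ennreal y"
          using y by (simp add: J_def measure_interval_def not_less)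
        have "rearr u y = 0"
        proof (rule rearr_eq_0)
          fix s :: real
          have "{x. ennreal s < u x} \<subseteq> \<Omega>"
            by (auto simp: u_def extend_by_zero_def simp flip: zero_ennreal_def split: if_splits)
          then have "tail_measure u s \<le> emeasure lebesgue \<Omega>"
            unfolding tail_measure_def by (rule emeasure_mono[OF _ Omega])
          with le show "tail_measure u s \<le> ennreal y" by simp
        qed
        then show ?thesis using False by (simp add: extend_by_zero_def flip: zero_ennreal_def)
      qed
    qed (use that in simp)
    \<comment> \<open>The two functions are known to agree for positive arguments only; the norm
      sees \<open>J\<close> alone, so the lattice property allows the replacement.\<close>
    have "NY' (\<lambda>t. enn2ereal (H t)) \<le> NY' (\<lambda>t. enn2ereal (hardy_operator (\<alpha> / n) \<psi> (extend_by_zero J \<phi>) t))"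
    proof (rule function_space_mono[OF QY'])
      have J_pos: "0 < t" if "t \<in> J" for t
        using that by (simp add: J_def measure_interval_def)
      show "(\<lambda>t. enn2ereal (H t)) \<in> borel_measurable (lebesgue_on J)"
        by (rule borel_measurable_enn2ereal_restrict[OF H_leb(2)])
      also have "?this \<longleftrightarrow> (\<lambda>t. enn2ereal (hardy_operator (\<alpha> / n) \<psi> (extend_by_zero J \<phi>) t))
          \<in> borel_measurable (lebesgue_on J)"
        by (intro measurable_cong) (auto simp: H_eq J_pos)
      finally show "(\<lambda>t. enn2ereal (hardy_operator (\<alpha> / n) \<psi> (extend_by_zero J \<phi>) t))
          \<in> borel_measurable (lebesgue_on J)" .
      show "\<bar>enn2ereal (H t)\<bar> \<le> \<bar>enn2ereal (hardy_operator (\<alpha> / n) \<psi> (extend_by_zero J \<phi>) t)\<bar>" if "t \<in> J" for t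
        using H_eq[OF J_pos[OF that]] by simp
    qed
    also have "\<dots> \<le> ennreal c * NX' \<phi>"
      using f C by (intro bound) (auto simp: NX_\<phi> \<phi>_eq ennreal_mult_less_top)
    finally have NY_H: "NY' (\<lambda>t. enn2ereal (H t)) \<le> ennreal c * (ennreal C * NX f)"
      by (simp add: NX_\<phi>)
    \<comment> \<open>Homogeneity is stated for members, so finiteness precedes the extraction of
      \<open>A\<close>.\<close>
    then have NY_H_fin: "NY' (\<lambda>t. enn2ereal (H t)) < \<infinity>"
      using f by (auto simp: ennreal_mult_less_top intro: le_less_trans)
    have AH: "(\<lambda>t. ereal A * enn2ereal (H t)) = (\<lambda>t. enn2ereal (ennreal A * H t))"
      using A by (simp add: times_ennreal.rep_eq)
    have NY_AH: "NY' (\<lambda>t. enn2ereal (ennreal A * H t)) \<le> ennreal (A * c * C) * NX f"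
    proof -
      have "NY' (\<lambda>t. enn2ereal (ennreal A * H t)) = ennreal A * NY' (\<lambda>t. enn2ereal (H t))"
        using function_space_scale[OF QY' NY_H_fin, of A] A by (simp add: AH)
      also have "\<dots> \<le> ennreal A * (ennreal c * (ennreal C * NX f))"
        by (rule mult_left_mono[OF NY_H]) simp
      also have "\<dots> = ennreal (A * c * C) * NX f"
        using A c C by (simp add: ennreal_mult mult.assoc)
      finally show ?thesis .
    qed
    have "NY (\<lambda>x. enn2ereal (W x)) \<le> ennreal (A * c * C) * NX f"
    proof (rule function_space_Fatou[OF Y, where w = "\<lambda>k. truncate k W"])
      fix k
      define w where "w = truncate k W"
      have w: "w \<in> borel_measurable lebesgue"
        unfolding w_def by (rule borel_measurable_truncate[OF W])
      have "NY (\<lambda>x. enn2ereal (w x)) < \<infinity>"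
      proof (rule function_space_bounded[OF Y w])
        show "ball 0 (real k) \<inter> \<Omega> \<in> sets lebesgue" using Omega by (simp add: sets.Int)
        have "emeasure lebesgue (ball 0 (real k) \<inter> \<Omega>) \<le> emeasure lebesgue (ball (0::'a) (real k))"
          by (rule emeasure_mono) auto
        also have "\<dots> < \<infinity>"
          using emeasure_lborel_ball_finite[of "0::'a" "real k"] by simp
        finally show "emeasure lebesgue (ball 0 (real k) \<inter> \<Omega>) < \<infinity>" .
        show "w x \<le> ennreal (real k) * indicator (ball 0 (real k) \<inter> \<Omega>) x" if "x \<in> \<Omega>" for x
          using truncate_le_indicator[of k W x] that by (simp add: w_def indicator_def)
      qed auto
      then have "NY (\<lambda>x. enn2ereal (w x)) = NY' (decreasing_rearrangement \<Omega> (\<lambda>x. enn2ereal (w x)))"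
        by (rule representation_space_norm[OF Y', symmetric])
      \<comment> \<open>The rearrangement over \<open>\<Omega>\<close> ignores values outside, hence
        the indicator. Restricting and truncating only lower the rearrangement.\<close>
      also have "decreasing_rearrangement \<Omega> (\<lambda>x. enn2ereal (w x)) =
          (\<lambda>t. enn2ereal (rearr (\<lambda>x. w x * indicator \<Omega> x) t))"
        by (rule decreasing_rearrangement_eq_rearr) simp_all
      also have "NY' \<dots> \<le> NY' (\<lambda>t. enn2ereal (ennreal A * H t))"
      proof (rule function_space_mono[OF QY'])
        show "(\<lambda>t. enn2ereal (ennreal A * H t)) \<in> borel_measurable (lebesgue_on J)"
          by (rule borel_measurable_enn2ereal_restrict[OF H_leb(1)])
        show "(\<lambda>t. enn2ereal (rearr (\<lambda>x. w x * indicator \<Omega> x) t)) \<in> borel_measurable (lebesgue_on J)"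
          by (rule borel_measurable_enn2ereal_restrict[OF lebesgue_measurable_rearr])
        fix t assume "t \<in> J"
        then have "0 < t" by (simp add: J_def measure_interval_def)
        have "rearr (\<lambda>x. w x * indicator \<Omega> x) t \<le> rearr W t"
          using truncate_le[of k W] by (intro rearr_mono[OF W]) (auto simp: w_def indicator_def)
        also have "\<dots> \<le> ennreal A * H t"
          by (rule W_le[OF \<open>0 < t\<close>])
        finally show "\<bar>enn2ereal (rearr (\<lambda>x. w x * indicator \<Omega> x) t)\<bar> \<le> \<bar>enn2ereal (ennreal A * H t)\<bar>"
          by (simp add: less_eq_ennreal.rep_eq)
      qed
      also note NY_AH
      finally show "NY (\<lambda>x. enn2ereal (truncate k W x)) \<le> ennreal (A * c * C) * NX f"
        by (simp add: w_def)
      show "truncate k W \<in> borel_measurable (lebesgue_on \<Omega>)"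
        using w by (simp add: w_def measurable_restrict_space1)
    qed (simp_all add: incseq_truncate SUP_truncate)
    then show ?thesis
      by (simp add: W_def P_def u_def[abs_def] wolff_potential_eq_wolff_op)
  qed
  moreover have "0 < A * c * C" using A c C by simp
  ultimately show ?thesis
    unfolding potential_bounded_def by blast
qed

lemma measure_interval_UNIV: "measure_interval (UNIV :: 'a::euclidean_space set) = {0<..}"
  by (auto simp: measure_interval_def)

text \<open>Members of \<open>X\<close> may have superlevel sets of infinite measure, to which the hypothesis does not apply;
  the bound is first shown for truncations and then passes to the limit, which is where the left
  continuity of \<open>\<psi>\<close> enters.\<close>

lemma hardy_boundedI:
  fixes \<psi> :: "real \<Rightarrow> real" and NX NY :: "('a::euclidean_space \<Rightarrow> ereal) \<Rightarrow> ennreal"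
  assumes mono: "mono_on {0..} \<psi>" and left: "\<forall>s>0. continuous (at_left s) \<psi>"
    and alpha: "0 < \<alpha>" "\<alpha> < real DIM('a)"
    and X: "quasi_normed_function_space UNIV NX"
    and X': "representation_space UNIV NX NX'"
    and Y': "representation_space UNIV NY NY'"
    and potential: "potential_bounded \<alpha> \<psi> UNIV NX NY"
  shows "hardy_bounded \<alpha> \<psi> (UNIV :: 'a set) NX' NY'"
proof -
  define n where "n = real DIM('a)"
  define \<omega> where "\<omega> = unit_ball_vol n"
  define \<kappa> where "\<kappa> = \<omega> powr (-1 / n)"
  define d where "d = 3 * \<kappa>"
  \<comment> \<open>Reciprocal of the prefactor in \<open>radial_wolff_op_ge_hardy_op\<close>;
    \<open>D\<close> is the constant that stays inside \<psi>.\<close>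
  define A where "A = n / d powr \<alpha>"
  define D where "D = d powr (\<alpha> - n)"
  define P where "P = extend_at_infinity \<psi>"
  define J where "J = {0::real<..}"
  have omega: "0 < \<omega>" by (simp add: \<omega>_def n_def)
  have d: "0 < d" using omega by (simp add: d_def \<kappa>_def)
  have n: "0 < n" "\<alpha> < n" using alpha by (simp_all add: n_def)
  have A: "0 < A" and D: "0 < D" using d n by (simp_all add: A_def D_def)
  have P: "mono P" unfolding P_def by (rule mono_extend_at_infinity[OF mono])
  have J: "J = measure_interval (UNIV :: 'a set)" by (simp add: J_def measure_interval_UNIV)
  have J_sets: "J \<in> sets lebesgue" by (simp add: J_def)
  note QX' = representation_space_quasi_normed[OF X', folded J]
  note QY' = representation_space_quasi_normed[OF Y', folded J]
  obtain c where c: "0 < c" and bound: "\<And>f. NX f < \<infinity> \<Longrightarrow> (\<And>\<tau>. 0 < \<tau> \<Longrightarrow> distribution_on UNIV f \<tau> < \<infinity>) \<Longrightarrow>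
      NY (\<lambda>x. enn2ereal (wolff_potential \<alpha> \<psi> (extend_by_zero UNIV f) x)) \<le> ennreal c * NX f"
    using potential unfolding potential_bounded_def by blast
  have equimeasurable: "NX' f = NX' g"
    if "f \<in> borel_measurable (lebesgue_on J)" "g \<in> borel_measurable (lebesgue_on J)"
      "\<And>t. t \<in> J \<Longrightarrow> \<bar>f t\<bar> < \<infinity>" "\<And>t. t \<in> J \<Longrightarrow> \<bar>g t\<bar> < \<infinity>"
      "\<And>s. 0 < s \<Longrightarrow> distribution_on J f s = distribution_on J g s" for f g
  proof -
    have "AE t in lebesgue_on J. \<bar>f t\<bar> < \<infinity>" "AE t in lebesgue_on J. \<bar>g t\<bar> < \<infinity>"
      by (rule AE_I2; rule that; simp)+
    then show ?thesis
      using that X'[unfolded representation_space_def rearrangement_invariant_space_def, folded J,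
        THEN conjunct1, THEN conjunct2, rule_format, of f g] by blast
  qed
  \<comment> \<open>Bounded functions with bounded support meet all finiteness conditions:
    membership, superlevel sets of finite measure, and finite values, for which rearrangement
    invariance is stated. The constant is independent of \<open>k\<close>.\<close>
  have key: "NY' (\<lambda>t. enn2ereal (hardy_op (\<alpha> / n) P (\<lambda>y. ennreal D * u y) t)) \<le>
      ennreal (A * c) * NX' (\<lambda>t. enn2ereal (u t))"
    if u: "u \<in> borel_measurable lebesgue" and u_bound: "\<And>t. u t \<le> ennreal (real k) * indicator (ball 0 (real k)) t"
      and u_J: "\<And>t. t \<notin> J \<Longrightarrow> u t = 0" for u and k :: nat
  proof -
    define v where "v = rearr u"
    define g where "g x = v (\<omega> * norm x ^ DIM('a))" for x :: 'a
    define W where "W = wolff_op \<alpha> P g"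
    define H where "H = hardy_op (\<alpha> / n) P (\<lambda>y. ennreal D * u y)"
    have v_borel [measurable]: "v \<in> borel_measurable borel" by (simp add: v_def)
    have v_leb: "v \<in> borel_measurable lebesgue" by (simp add: v_def)
    have g_borel [measurable]: "g \<in> borel_measurable borel"
      unfolding g_def by measurable
    then have g: "g \<in> borel_measurable lebesgue"
      by (simp add: measurable_completion)
    have u_le: "u t \<le> ennreal (real k)" for t
      by (rule order_trans[OF u_bound]) (simp add: indicator_def)
    \<comment> \<open>\<open>2 * real k\<close> is the length of the interval
      \<open>ball 0 (real k)\<close>; from there on \<open>v\<close> vanishes.\<close>
    have tail_u: "tail_measure u s \<le> ennreal (2 * real k)" if "0 \<le> s" for s
    proof -
      have "{t. ennreal s < u t} \<subseteq> ball 0 (real k)"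
      proof (rule subsetI, rule ccontr)
        fix t assume "t \<in> {t. ennreal s < u t}" "t \<notin> ball 0 (real k)"
        then show False using u_bound[of t] by simp
      qed
      then have "tail_measure u s \<le> emeasure lebesgue (ball (0::real) (real k))"
        unfolding tail_measure_def by (intro emeasure_mono) auto
      also have "\<dots> = ennreal (2 * real k)"
        by (simp add: ball_eq_greaterThanLessThan)
      finally show ?thesis .
    qed
    have v_le: "v t \<le> ennreal (real k)" for t
      unfolding v_def
    proof (rule ennreal_le_of_real_less)
      fix s :: real assume s: "0 \<le> s" "ennreal s < rearr u t"
      then have "ennreal t < tail_measure u s" by (simp add: less_rearr_iff[OF u])
      then have "{t. ennreal s < u t} \<noteq> {}" unfolding tail_measure_def by (metis emeasure_empty not_less_zero)
      then obtain t' where "ennreal s < u t'" by blast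
      also have "u t' \<le> ennreal (real k)"
        by (rule u_le)
      finally show "ennreal s \<le> ennreal (real k)" by (rule less_imp_le)
    qed
    have v_0: "v t = 0" if "2 * real k \<le> t" for t
      unfolding v_def
      by (rule rearr_eq_0) (use tail_u that ennreal_leI order_trans in blast)
    \<comment> \<open>The set where \<open>v\<close> exceeds \<open>s\<close> is the interval from 0
      of length \<open>tail_measure u s\<close>, so \<open>u\<close> and its rearrangement are
      equimeasurable.\<close>
    have tail_v: "emeasure lebesgue {t\<in>J. ennreal s < v t} = tail_measure u s" if "0 \<le> s" for s
    proof -
      have "{t\<in>J. ennreal s < v t} = {t. 0 < t \<and> ennreal t < tail_measure u s}"
        using less_rearr_iff[OF u that] by (auto simp: J_def v_def)
      moreover have "{t. 0 < t \<and> ennreal t < tail_measure u s} \<in> sets borel"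
        by measurable
      ultimately show ?thesis
        using emeasure_less_ennreal[of "tail_measure u s"] by simp
    qed
    have tail_g: "tail_measure g s = tail_measure u s" if "0 \<le> s" for s
    proof -
      have "tail_measure g s = emeasure lborel {x::'a. \<omega> * norm x ^ DIM('a) \<in> {t. ennreal s < v t}}"
        by (simp add: tail_measure_def g_def)
      also have "\<dots> = emeasure lborel ({t. ennreal s < v t} \<inter> {0<..})"
        unfolding \<omega>_def n_def by (rule emeasure_radial) measurable
      also have "{t. ennreal s < v t} \<inter> {0<..} = {t\<in>J. ennreal s < v t}"
        by (auto simp: J_def)
      also have "emeasure lborel \<dots> = emeasure lebesgue {t\<in>J. ennreal s < v t}"
        by (simp add: J_def)
      finally show ?thesis using tail_v[OF that] by simp
    qed
    have rearr_g: "rearr g = v"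
      unfolding v_def by (rule rearr_eqI) (rule tail_g)
    have rearr_ext: "decreasing_rearrangement UNIV (\<lambda>x. enn2ereal (w x)) = (\<lambda>t. enn2ereal (rearr w t))"
      for w :: "'a \<Rightarrow> ennreal"
      by (rule decreasing_rearrangement_eq_rearr) simp_all
    have NX_g: "NX (\<lambda>x. enn2ereal (g x)) < \<infinity>"
    proof (rule function_space_bounded[OF X g])
      let ?E = "{x::'a. \<omega> * norm x ^ DIM('a) \<le> 2 * real k}"
      have "?E \<in> sets borel" by measurable
      then show "?E \<in> sets lebesgue" by simp
      show "emeasure lebesgue ?E < \<infinity>"
        using emeasure_radial_atMost[where 'a='a, of "2 * real k"] \<open>?E \<in> sets borel\<close>
        by (simp add: \<omega>_def n_def)
      show "g x \<le> ennreal (real k) * indicator ?E x" for x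
        using v_le v_0[of "\<omega> * norm x ^ DIM('a)"] by (auto simp: g_def indicator_def)
    qed auto
    \<comment> \<open>The representation norm sees \<open>g\<close> through
      \<open>rearr g = v\<close>; rearrangement invariance then replaces \<open>v\<close> by
      \<open>u\<close>.\<close>
    have NX_eq: "NX (\<lambda>x. enn2ereal (g x)) = NX' (\<lambda>t. enn2ereal (u t))"
    proof -
      have "NX (\<lambda>x. enn2ereal (g x)) = NX' (\<lambda>t. enn2ereal (v t))"
        using representation_space_norm[OF X' NX_g] by (simp add: rearr_ext rearr_g)
      also have "\<dots> = NX' (\<lambda>t. enn2ereal (u t))"
      proof (rule equimeasurable)
        have fin: "\<bar>enn2ereal a\<bar> < \<infinity>" if "a \<le> ennreal (real k)" for a
          using that by (cases a) (auto simp: top_unique)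
        show "\<bar>enn2ereal (v t)\<bar> < \<infinity>" for t by (rule fin[OF v_le])
        show "\<bar>enn2ereal (u t)\<bar> < \<infinity>" for t
          by (rule fin[OF u_le])
        fix s :: real assume s: "0 < s"
        have "distribution_on J (\<lambda>t. enn2ereal (u t)) s = tail_measure u s"
          using s u_J by (intro distribution_on_eq_tail_measure) auto
        moreover have "distribution_on J (\<lambda>t. enn2ereal (v t)) s = emeasure lebesgue {t\<in>J. ennreal s < v t}"
          unfolding distribution_on_def using s by (simp add: less_ennreal.rep_eq)
        ultimately show "distribution_on J (\<lambda>t. enn2ereal (v t)) s = distribution_on J (\<lambda>t. enn2ereal (u t)) s"
          using tail_v[of s] s by simp
      qed (rule borel_measurable_enn2ereal_restrict u v_leb)+
      finally show ?thesis .
    qed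
    have W: "W \<in> borel_measurable lebesgue"
      using borel_measurable_wolff_op[OF P g] by (simp add: W_def measurable_completion)
    have NY_W: "NY (\<lambda>x. enn2ereal (W x)) \<le> ennreal c * NX (\<lambda>x. enn2ereal (g x))"
    proof -
      have "distribution_on UNIV (\<lambda>x. enn2ereal (g x)) \<tau> < \<infinity>" if "0 < \<tau>" for \<tau>
      proof -
        have "distribution_on UNIV (\<lambda>x. enn2ereal (g x)) \<tau> = tail_measure g \<tau>"
          using that by (intro distribution_on_eq_tail_measure) auto
        also have "\<dots> \<le> ennreal (2 * real k)"
          using tail_g[of \<tau>] tail_u[of \<tau>] that by simp
        finally show ?thesis by (auto intro: le_less_trans)
      qed
      from bound[OF NX_g this] show ?thesis
        by (simp add: W_def P_def wolff_potential_eq_wolff_op extend_by_zero_def)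
    qed
    \<comment> \<open>Here the hypothesis itself places \<open>W\<close> in Y, so its rearrangement
      can be used without truncating \<open>W\<close>.\<close>
    then have NY_W_fin: "NY (\<lambda>x. enn2ereal (W x)) < \<infinity>"
      using NX_g by (auto simp: ennreal_mult_less_top intro: le_less_trans)
    then have NY_rearr: "NY' (\<lambda>t. enn2ereal (rearr W t)) = NY (\<lambda>x. enn2ereal (W x))"
      using representation_space_norm[OF Y' NY_W_fin] by (simp add: rearr_ext)
    have H_le: "H t \<le> ennreal A * rearr W t" if t: "0 < t" for t
    proof -
      \<comment> \<open>The Hardy operator depends on initial integrals only, and rearranging
        increases these.\<close>
      have "H t \<le> hardy_op (\<alpha> / n) P (\<lambda>y. ennreal D * v y) t"
        unfolding H_def
      proof (rule hardy_op_mono[OF P])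
        fix s :: real assume s: "0 < s"
        have "(\<integral>\<^sup>+y\<in>{0<..<s}. u y \<partial>lebesgue) \<le> (\<integral>\<^sup>+y\<in>{0<..<s}. v y \<partial>lebesgue)"
          unfolding v_def rearr_initial_integral_lebesgue
          using s by (intro Hardy_Littlewood[OF u]) auto
        then show "(\<integral>\<^sup>+y\<in>{0<..<s}. ennreal D * u y \<partial>lebesgue) \<le> (\<integral>\<^sup>+y\<in>{0<..<s}. ennreal D * v y \<partial>lebesgue)"
          using u v_leb by (simp add: set_nn_integral_cmult mult_left_mono)
      qed (use t in simp)
      also have "\<dots> = ennreal A * (ennreal (d powr \<alpha> / n) * hardy_op (\<alpha> / n) P (\<lambda>y. ennreal D * v y) t)"
        using d n by (simp add: A_def flip: mult.assoc ennreal_mult)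
      also have "\<dots> \<le> ennreal A * rearr W t"
      proof (rule mult_left_mono[OF le_rearr[OF W]])
        let ?B = "ball (0::'a) (2 * \<kappa> * t powr (1 / n))"
        show "?B \<in> sets lebesgue" by simp
        have "\<omega> * (2 * \<kappa> * t powr (1 / n)) ^ DIM('a) = 2 ^ DIM('a) * t"
        proof -
          have "\<kappa> powr n = \<omega> powr (-1)"
            unfolding \<kappa>_def powr_powr using n by simp
          then have "(2 * \<kappa> * t powr (1 / n)) powr n = 2 powr n * inverse \<omega> * t"
            using omega t n by (simp add: powr_mult powr_powr powr_minus \<kappa>_def)
          moreover have "(2 * \<kappa> * t powr (1 / n)) powr n = (2 * \<kappa> * t powr (1 / n)) ^ DIM('a)"
            using omega t by (simp add: n_def powr_realpow \<kappa>_def)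
          ultimately have "(2 * \<kappa> * t powr (1 / n)) ^ DIM('a) = 2 ^ DIM('a) * inverse \<omega> * t"
            by (simp add: n_def powr_realpow)
          then show ?thesis
            using omega by simp
        qed
        then have "emeasure lebesgue ?B = ennreal (2 ^ DIM('a) * t)"
          using omega t emeasure_ball_eq[of "2 * \<kappa> * t powr (1 / n)" "0::'a"]
          by (simp add: \<omega>_def n_def \<kappa>_def)
        \<comment> \<open>The factor 2 in the radius yields the strict inequality demanded by
          \<open>le_rearr\<close>.\<close>
        moreover have "t < 2 ^ DIM('a) * t"
          using t by simp
        ultimately show "ennreal t < emeasure lebesgue ?B"
          using t by (simp add: ennreal_less_iff)
        show "ennreal (d powr \<alpha> / n) * hardy_op (\<alpha> / n) P (\<lambda>y. ennreal D * v y) t \<le> W x" if "x \<in> ?B" for x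
          unfolding W_def g_def[abs_def] D_def d_def \<kappa>_def \<omega>_def n_def
          by (rule radial_wolff_op_ge_hardy_op)
            (use alpha P v_borel t that in \<open>simp_all add: \<kappa>_def \<omega>_def n_def\<close>)
      qed simp
      finally show ?thesis .
    qed
    have "NY' (\<lambda>t. enn2ereal (H t)) \<le> NY' (\<lambda>t. ereal A * enn2ereal (rearr W t))"
    proof (rule function_space_mono[OF QY'])
      have eq: "(\<lambda>t. ereal A * enn2ereal (rearr W t)) = (\<lambda>t. enn2ereal (ennreal A * rearr W t))"
        using A by (simp add: times_ennreal.rep_eq)
      show "(\<lambda>t. ereal A * enn2ereal (rearr W t)) \<in> borel_measurable (lebesgue_on J)"
        unfolding eq by (rule borel_measurable_enn2ereal_restrict) (simp add: measurable_completion)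
      show "(\<lambda>t. enn2ereal (H t)) \<in> borel_measurable (lebesgue_on J)"
        by (rule borel_measurable_enn2ereal_restrict) (simp add: H_def measurable_completion)
      show "\<bar>enn2ereal (H t)\<bar> \<le> \<bar>ereal A * enn2ereal (rearr W t)\<bar>" if "t \<in> J" for t
        using H_le[of t] that by (simp add: J_def fun_cong[OF eq] less_eq_ennreal.rep_eq)
    qed
    also have "\<dots> = ennreal A * NY (\<lambda>x. enn2ereal (W x))"
      using function_space_scale[OF QY', of "\<lambda>t. enn2ereal (rearr W t)" A] NY_W_fin A by (simp add: NY_rearr)
    also have "\<dots> \<le> ennreal A * (ennreal c * NX (\<lambda>x. enn2ereal (g x)))"
      by (rule mult_left_mono[OF NY_W]) simp
    also have "\<dots> = ennreal (A * c) * NX' (\<lambda>t. enn2ereal (u t))"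
      using A c by (simp add: NX_eq ennreal_mult mult.assoc)
    finally show ?thesis unfolding H_def .
  qed
  have "NY' (\<lambda>t. enn2ereal (hardy_operator (\<alpha> / n) \<psi> (extend_by_zero J \<phi>) t)) \<le> ennreal (A * c / D) * NX' \<phi>"
    if \<phi>: "NX' \<phi> < \<infinity>" and nonneg: "\<And>t. t \<in> J \<Longrightarrow> 0 \<le> \<phi> t" for \<phi>
  proof -
    \<comment> \<open>Dividing by \<open>D\<close> in advance cancels the constant inside \<psi>;
      homogeneity charges a factor \<open>1 / D\<close> outside.\<close>
    define u where "u t = ennreal (1 / D) * e2ennreal \<bar>extend_by_zero J \<phi> t\<bar>" for t
    have \<phi>_meas: "\<phi> \<in> borel_measurable (lebesgue_on J)"
      by (rule function_space_measurable[OF QX' \<phi>])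
    have u: "u \<in> borel_measurable lebesgue"
      unfolding u_def
      by (intro borel_measurable_times_ennreal borel_measurable_const borel_measurable_extend_by_zero \<phi>_meas J_sets)
    have Du: "ennreal D * u t = e2ennreal (extend_by_zero J \<phi> t)" for t
    proof -
      have "ennreal D * u t = ennreal (D * (1 / D)) * e2ennreal \<bar>extend_by_zero J \<phi> t\<bar>"
        unfolding u_def mult.assoc[symmetric] using D by (subst ennreal_mult) auto
      then show ?thesis using D nonneg by (simp add: extend_by_zero_def)
    qed
    have NX_u: "NX' (\<lambda>t. enn2ereal (u t)) \<le> ennreal (1 / D) * NX' \<phi>"
    proof -
      have "NX' (\<lambda>t. enn2ereal (u t)) \<le> NX' (\<lambda>t. ereal (1 / D) * \<phi> t)"
      proof (rule function_space_mono[OF QX'])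
        show "(\<lambda>t. ereal (1 / D) * \<phi> t) \<in> borel_measurable (lebesgue_on J)"
          using \<phi>_meas by simp
        show "(\<lambda>t. enn2ereal (u t)) \<in> borel_measurable (lebesgue_on J)"
          by (rule borel_measurable_enn2ereal_restrict[OF u])
        show "\<bar>enn2ereal (u t)\<bar> \<le> \<bar>ereal (1 / D) * \<phi> t\<bar>" if "t \<in> J" for t
          using that nonneg[OF that] D
          by (simp add: u_def extend_by_zero_def times_ennreal.rep_eq enn2ereal_e2ennreal)
      qed
      also have "\<dots> = ennreal (1 / D) * NX' \<phi>"
        using function_space_scale[OF QX' \<phi>, of "1 / D"] D by simp
      finally show ?thesis .
    qed
    have trunc_meas: "truncate k u \<in> borel_measurable lebesgue" for k
      by (rule borel_measurable_truncate[OF u])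
    have Dtrunc_meas: "(\<lambda>y. ennreal D * truncate k u y) \<in> borel_measurable lebesgue" for k
      using trunc_meas by simp
    \<comment> \<open>Along the truncations of \<open>u\<close> the Hardy operator increases to that
      of \<open>u\<close>, and the bound from \<open>key\<close> is the same at all levels.\<close>
    have "NY' (\<lambda>t. enn2ereal (hardy_op (\<alpha> / n) P (\<lambda>y. ennreal D * u y) t)) \<le> ennreal (A * c) * (ennreal (1 / D) * NX' \<phi>)"
    proof (rule function_space_Fatou[OF QY', where w = "\<lambda>k. hardy_op (\<alpha> / n) P (\<lambda>y. ennreal D * truncate k u y)"])
      fix k
      have "NY' (\<lambda>t. enn2ereal (hardy_op (\<alpha> / n) P (\<lambda>y. ennreal D * truncate k u y) t)) \<le>
          ennreal (A * c) * NX' (\<lambda>t. enn2ereal (truncate k u t))"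
        by (rule key[OF trunc_meas truncate_le_indicator])
          (simp add: truncate_def u_def extend_by_zero_def flip: zero_ennreal_def)
      also have "\<dots> \<le> ennreal (A * c) * (ennreal (1 / D) * NX' \<phi>)"
      proof (intro mult_left_mono order_trans[OF _ NX_u] function_space_mono[OF QX'])
        show "\<bar>enn2ereal (truncate k u t)\<bar> \<le> \<bar>enn2ereal (u t)\<bar>" for t
          using truncate_le[of k u t] by (simp add: less_eq_ennreal.rep_eq)
      qed (simp_all add: borel_measurable_enn2ereal_restrict u trunc_meas)
      finally show "NY' (\<lambda>t. enn2ereal (hardy_op (\<alpha> / n) P (\<lambda>y. ennreal D * truncate k u y) t)) \<le>
          ennreal (A * c) * (ennreal (1 / D) * NX' \<phi>)" .
      show "hardy_op (\<alpha> / n) P (\<lambda>y. ennreal D * truncate k u y) \<in> borel_measurable (lebesgue_on J)"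
        by (rule measurable_restrict_space1) (simp add: measurable_completion)
    next
      fix t assume "t \<in> J"
      then have t: "0 \<le> t" by (simp add: J_def)
      show "incseq (\<lambda>k. hardy_op (\<alpha> / n) P (\<lambda>y. ennreal D * truncate k u y) t)"
        using incseq_SucD[OF incseq_truncate]
        by (intro incseq_SucI hardy_op_mono[OF P _ t] nn_integral_mono mult_right_mono mult_left_mono) auto
      have "(SUP k. hardy_op (\<alpha> / n) P (\<lambda>y. ennreal D * truncate k u y) t) =
          hardy_op (\<alpha> / n) P (\<lambda>y. SUP k. ennreal D * truncate k u y) t"
      proof (rule hardy_op_SUP[symmetric, OF P])
        show "P (SUP k. w k) = (SUP k. P (w k))" for w :: "nat \<Rightarrow> ennreal"
          unfolding P_def by (rule extend_at_infinity_SUP[OF mono left])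
        show "incseq (\<lambda>k y. ennreal D * truncate k u y)"
          using incseq_SucD[OF incseq_truncate] by (intro incseq_SucI le_funI mult_left_mono) auto
      qed (rule Dtrunc_meas)
      also have "(\<lambda>y. SUP k. ennreal D * truncate k u y) = (\<lambda>y. ennreal D * u y)"
        by (simp add: SUP_truncate flip: SUP_mult_left_ennreal)
      finally show "(SUP k. hardy_op (\<alpha> / n) P (\<lambda>y. ennreal D * truncate k u y) t) =
          hardy_op (\<alpha> / n) P (\<lambda>y. ennreal D * u y) t" .
    qed
    moreover have "NY' (\<lambda>t. enn2ereal (hardy_operator (\<alpha> / n) \<psi> (extend_by_zero J \<phi>) t)) \<le>
        NY' (\<lambda>t. enn2ereal (hardy_op (\<alpha> / n) P (\<lambda>y. ennreal D * u y) t))"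
    proof -
      have eq: "hardy_operator (\<alpha> / n) \<psi> (extend_by_zero J \<phi>) t = hardy_op (\<alpha> / n) P (\<lambda>y. ennreal D * u y) t"
        if "t \<in> J" for t
        unfolding P_def using that Du by (intro hardy_operator_eq_hardy_op) (auto simp: J_def)
      have meas: "(\<lambda>t. enn2ereal (hardy_op (\<alpha> / n) P (\<lambda>y. ennreal D * u y) t)) \<in> borel_measurable (lebesgue_on J)"
        by (rule borel_measurable_enn2ereal_restrict) (simp add: measurable_completion)
      also have "?this \<longleftrightarrow> (\<lambda>t. enn2ereal (hardy_operator (\<alpha> / n) \<psi> (extend_by_zero J \<phi>) t))
          \<in> borel_measurable (lebesgue_on J)"
        by (intro measurable_cong) (simp add: eq)
      finally show ?thesis
        using meas by (intro function_space_mono[OF QY']) (simp_all add: eq)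
    qed
    ultimately have "NY' (\<lambda>t. enn2ereal (hardy_operator (\<alpha> / n) \<psi> (extend_by_zero J \<phi>) t)) \<le>
        ennreal (A * c) * (ennreal (1 / D) * NX' \<phi>)"
      by (rule order_trans[rotated])
    also have "\<dots> = ennreal (A * c / D) * NX' \<phi>"
      using A c D ennreal_mult[of "A * c" "1 / D"] by (simp flip: mult.assoc)
    finally show ?thesis .
  qed
  moreover have "0 < A * c / D" using A c D by simp
  ultimately show ?thesis
    unfolding hardy_bounded_def J[symmetric] n_def[symmetric] by blast
qed

theorem theorem2:
  fixes \<psi> :: "real \<Rightarrow> real"
    and \<alpha> :: real
    and \<Omega> :: "'a::euclidean_space set"
    and NX NY :: "('a \<Rightarrow> ereal) \<Rightarrow> ennreal"
    and NX' NY' :: "(real \<Rightarrow> ereal) \<Rightarrow> ennreal"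
  assumes psi_nonneg: "\<forall>s\<ge>0. 0 \<le> \<psi> s"
    and psi_mono: "mono_on {0..} \<psi>"
    and psi_left_cont: "\<forall>s>0. continuous (at_left s) \<psi>"
    and alpha: "0 < \<alpha>" "\<alpha> < real DIM('a)"
    and Omega: "\<Omega> \<in> sets lebesgue"
    and X: "rearrangement_invariant_space \<Omega> NX"
    and Y: "rearrangement_invariant_space \<Omega> NY"
    and X': "representation_space \<Omega> NX NX'"
    and Y': "representation_space \<Omega> NY NY'"
  shows "(hardy_bounded \<alpha> \<psi> \<Omega> NX' NY' \<longrightarrow> potential_bounded \<alpha> \<psi> \<Omega> NX NY) \<and>
         (\<Omega> = UNIV \<longrightarrow> potential_bounded \<alpha> \<psi> \<Omega> NX NY \<longrightarrow> hardy_bounded \<alpha> \<psi> \<Omega> NX' NY')"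
proof (intro conjI impI)
  note QX = X[unfolded rearrangement_invariant_space_def, THEN conjunct1]
  note QY = Y[unfolded rearrangement_invariant_space_def, THEN conjunct1]
  show "potential_bounded \<alpha> \<psi> \<Omega> NX NY" if "hardy_bounded \<alpha> \<psi> \<Omega> NX' NY'"
    by (rule potential_boundedI[OF psi_mono alpha Omega QX QY X' Y' that])
  show "hardy_bounded \<alpha> \<psi> \<Omega> NX' NY'" if "\<Omega> = UNIV" and potential: "potential_bounded \<alpha> \<psi> \<Omega> NX NY"
    using hardy_boundedI[OF psi_mono psi_left_cont alpha QX[unfolded that(1)] X'[unfolded that(1)]
        Y'[unfolded that(1)] potential[unfolded that(1)]]
    unfolding that(1) .
qed

end
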